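(* Let $(T(t))_{t\in\Delta}$ be a $C_0$-semigroup on $E$, let $\delta>0$ and let $f:[0,\infty)\to[1,\infty)$ be an increasing mapping. Define $m_k:=f(k)$, $k\in\mathbb N_0$. Suppose that there are a sequence $(t_n)_{n\in\mathbb N}\subseteq\Delta\setminus\{0\}$, a dense subset $E_0$ of $E$ and mappings $S_n:E_0\to E$ ($n\in\mathbb N$) such that the following conditions hold for all $y\in E_0$: (i) The series $\sum_{n=1}^{k}T(t_{\lfloor m_k\rfloor})S_{\lfloor m_{k-n}\rfloor}y$, $k\in\mathbb N$, converge unconditionally, uniformly in $k\in\mathbb N$. (ii) The series $\sum_{n=1}^{\infty}T(t_{\lfloor m_k\rfloor})S_{\lfloor m_{k+n}\rfloor}y$ converges unconditionally, uniformly in $k\in\mathbb N$. (iii) The series $\sum_{n=1}^{\infty}S_{\lfloor m_n\rfloor}y$ converges unconditionally. (iv) $\lim_{n\to\infty}T(t_{\lfloor m_n\rfloor})S_{\lfloor m_n\rfloor}y=y$. (v) $|t_n-t_m|\ge\delta$ for $m\ne n$, and $g:[1,\infty)\to[1,\infty)$ is an increasing mapping with $|t_n|\le g(n)$ for all $n\in\mathbb N$. Then the sequence of operators $(T_n:=T(t_n))_{n\in\mathbb N}$ is l-$(m_k)$-frequently hypercyclic and $(T(t))_{t\in\Delta}$ is $(g\circ f)$-frequently hypercyclic.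
   Context: $E$ is a separable infinite-dimensional Fréchet space over $\mathbb K\in\{\mathbb R,\mathbb C\}$, with translation invariant metric $d$ inducing its topology. The index set $\Delta$ is one of $[0,\infty)$, $\mathbb R$, $\mathbb C$, or $\Delta(\alpha):=\{re^{i\theta}: r\ge 0,\ \theta\in[-\alpha,\alpha]\}$ for some $\alpha\in(0,\pi/2]$. For $s\ge0$, $\Delta_s:=\{t\in\Delta:|t|\le s\}$; $m(\cdot)$ is Lebesgue measure on $\Delta$. A $C_0$-semigroup $(T(t))_{t\in\Delta}$ on $E$ is a family of continuous linear operators on $E$ with $T(0)=I$, $T(t+s)=T(t)T(s)$ for $t,s\in\Delta$, and $t\mapsto T(t)x$ continuous for each $x\in E$; it is locally equicontinuous, i.e. $\{T(t):t\in\Delta_{t_0}\}$ is equicontinuous for every $t_0>0$. A collection of series $\sum_{n=1}^\infty x_{n,k}$, $k\in J$, is unconditionally convergent, uniformly in $k\in J$, iff for any $\epsilon>0$ there is $N\in\mathbb N$ such that for every finite $F\subseteq[N,\infty)\cap\mathbb N$ and every $k\in J$ one has $d(\sum_{n\in F}x_{n,k},0)<\epsilon$; for sums $\sum_{n=1}^k$ one puts $x_{n,k}=0$ for $n>k$. For $A\subseteq\mathbb N$, $\underline d_{m_k}(A):=\liminf_{n\to\infty}|A\cap[1,m_n]|/n$; for $A\subseteq\Delta$ and increasing $h:[0,\infty)\to[1,\infty)$, $\underline d_h(A):=\liminf_{t\to\infty}m(A\cap\Delta_{h(t)})/t$. A sequence of operators $(T_n)_{n\in\mathbb N}$ on $E$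 is l-$(m_k)$-frequently hypercyclic (also called l-$(m_k)$-hypercyclic) if there is $x\in E$ with $\underline d_{m_k}(\{n\in\mathbb N:T_nx\in V\})>0$ for every open non-empty $V\subseteq E$. The semigroup $(T(t))_{t\in\Delta}$ is $h$-frequently hypercyclic if there is $x\in E$ with $\underline d_h(\{t\in\Delta:T(t)x\in V\})>0$ for every open non-empty $V\subseteq E$. *)

theory Defs
  imports "HOL-Analysis.Analysis"
begin

text \<open>
  The scalar field is a type \<open>'k :: real_normed_field\<close>. Norms of this class are multiplicative, so by
  the Gelfand--Mazur theorem every instance is isometrically isomorphic to \<open>\<real>\<close> or \<open>\<complex>\<close>; the types
  \<^typ>\<open>real\<close> and \<^typ>\<open>complex\<close> are the two standard instances.
  The metric \<open>d\<close> is \<^const>\<open>dist\<close>; for a translation invariant metric, completeness of the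
  topological vector space and completeness of the metric coincide.
\<close>

locale frechet_space = vector_space sc
  for sc :: "'k::real_normed_field \<Rightarrow> 'e::{topological_ab_group_add,complete_space} \<Rightarrow> 'e" +
  assumes dist_translation_invariant: "dist (x + z) (y + z) = dist x (y :: 'e)"
    and continuous_scale: "continuous_on UNIV (\<lambda>(c, x). sc c x)"
    and locally_convex:
      "\<lbrakk>open U; 0 \<in> U\<rbrakk> \<Longrightarrow> \<exists>V. open V \<and> 0 \<in> V \<and> V \<subseteq> U \<and>
         (\<forall>x\<in>V. \<forall>y\<in>V. \<forall>u\<in>{0..1}. sc (of_real u) x + sc (of_real (1 - u)) y \<in> V)"

definition infinite_dimensional :: "('k::field \<Rightarrow> 'e::ab_group_add \<Rightarrow> 'e) \<Rightarrow> bool" where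
  "infinite_dimensional sc \<longleftrightarrow> (\<forall>B. finite B \<longrightarrow> module.span sc B \<noteq> UNIV)"

definition separable :: "'e::topological_space itself \<Rightarrow> bool" where
  "separable _ \<longleftrightarrow> (\<exists>D::'e set. countable D \<and> closure D = UNIV)"


text \<open>All index sets, including \<open>[0,\<infinity>)\<close> and \<open>\<real>\<close>, are regarded as subsets of \<open>\<complex>\<close>.\<close>

definition sector :: "real \<Rightarrow> complex set" where
  "sector \<alpha> = {of_real r * cis \<theta> | r \<theta>. 0 \<le> r \<and> \<theta> \<in> {-\<alpha>..\<alpha>}}"

definition index_set :: "complex set \<Rightarrow> bool" where
  "index_set \<Delta> \<longleftrightarrow> \<Delta> = complex_of_real ` {0..} \<or> \<Delta> = \<real> \<or> \<Delta> = UNIV \<or>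
     (\<exists>\<alpha>. 0 < \<alpha> \<and> \<alpha> \<le> pi / 2 \<and> \<Delta> = sector \<alpha>)"

definition initial_part :: "complex set \<Rightarrow> real \<Rightarrow> complex set" where
  "initial_part \<Delta> s = {t \<in> \<Delta>. cmod t \<le> s}"

text \<open>
  Lebesgue measure on \<open>\<Delta>\<close> is one-dimensional if \<open>\<Delta>\<close> lies in the real line and two-dimensional
  otherwise.
\<close>

definition index_measure :: "complex set \<Rightarrow> complex set \<Rightarrow> real" where
  "index_measure \<Delta> A = (if \<Delta> \<subseteq> \<real> then measure lebesgue (Re ` A) else measure lebesgue A)"

locale C0_semigroup = frechet_space sc
  for sc :: "'k::real_normed_field \<Rightarrow> 'e::{topological_ab_group_add,complete_space} \<Rightarrow> 'e" +
  fixes \<Delta> :: "complex set" and T :: "complex \<Rightarrow> 'e \<Rightarrow> 'e"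
  assumes index_set: "index_set \<Delta>"
    and linear_T: "t \<in> \<Delta> \<Longrightarrow> Vector_Spaces.linear sc sc (T t)"
    and continuous_T: "t \<in> \<Delta> \<Longrightarrow> continuous_on UNIV (T t)"
    and T_zero: "T 0 = id"
    and T_add: "\<lbrakk>t \<in> \<Delta>; s \<in> \<Delta>\<rbrakk> \<Longrightarrow> T (t + s) = T t \<circ> T s"
    and strongly_continuous: "continuous_on \<Delta> (\<lambda>t. T t x)"


text \<open>
  Series are indexed by \<open>n \<ge> 1\<close>. The argument \<open>x n k\<close> is the \<open>n\<close>-th term of the \<open>k\<close>-th series;
  a finite sum \<open>\<Sum>n=1..k\<close> is encoded by \<open>x n k = 0\<close> for \<open>n > k\<close>.
\<close>

definition uncond_convergent_uniformly ::
    "'j set \<Rightarrow> (nat \<Rightarrow> 'j \<Rightarrow> 'e::{comm_monoid_add,metric_space}) \<Rightarrow> bool" where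
  "uncond_convergent_uniformly J x \<longleftrightarrow>
     (\<forall>\<epsilon>>0. \<exists>N\<ge>1. \<forall>F. finite F \<and> F \<subseteq> {N..} \<longrightarrow> (\<forall>k\<in>J. dist (\<Sum>n\<in>F. x n k) 0 < \<epsilon>))"

definition uncond_convergent :: "(nat \<Rightarrow> 'e::{comm_monoid_add,metric_space}) \<Rightarrow> bool" where
  "uncond_convergent x \<longleftrightarrow> uncond_convergent_uniformly (UNIV :: unit set) (\<lambda>n _. x n)"


definition lower_density_seq :: "(nat \<Rightarrow> real) \<Rightarrow> nat set \<Rightarrow> ereal" where
  "lower_density_seq m A =
     liminf (\<lambda>n. ereal (real (card {j \<in> A. 1 \<le> j \<and> real j \<le> m n}) / real n))"

definition lower_density_index :: "complex set \<Rightarrow> (real \<Rightarrow> real) \<Rightarrow> complex set \<Rightarrow> ereal" where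
  "lower_density_index \<Delta> h A =
     Liminf at_top (\<lambda>t. ereal (index_measure \<Delta> (A \<inter> initial_part \<Delta> (h t)) / t))"

definition l_frequently_hypercyclic ::
    "(nat \<Rightarrow> real) \<Rightarrow> (nat \<Rightarrow> 'e \<Rightarrow> 'e::topological_space) \<Rightarrow> bool" where
  "l_frequently_hypercyclic m T \<longleftrightarrow>
     (\<exists>x. \<forall>V. open V \<and> V \<noteq> {} \<longrightarrow> lower_density_seq m {n. 1 \<le> n \<and> T n x \<in> V} > 0)"

definition semigroup_frequently_hypercyclic ::
    "complex set \<Rightarrow> (real \<Rightarrow> real) \<Rightarrow> (complex \<Rightarrow> 'e \<Rightarrow> 'e::topological_space) \<Rightarrow> bool" where
  "semigroup_frequently_hypercyclic \<Delta> h T \<longleftrightarrow>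
     (\<exists>x. \<forall>V. open V \<and> V \<noteq> {} \<longrightarrow> lower_density_index \<Delta> h {t \<in> \<Delta>. T t x \<in> V} > 0)"

end

theory Submission
  imports Defs
begin

text \<open>
  Put \<open>p k = \<lfloor>m k\<rfloor>\<close> and \<open>u k = T (t (p k))\<close>. As in the Frequent Hypercyclicity Criterion, choose pairwise disjoint
  sets \<open>A l\<close> of positive lower density whose elements are far apart and let \<open>x\<close> be the sum of all \<open>S (p n) y\<close>
  over \<open>n \<in> A l\<close>, with \<open>y\<close> close to a prescribed target; then \<open>u n x\<close> is close to this target for \<open>n \<in> A l\<close>.
  Conditions (i) and (iv) force \<open>p\<close> to be injective on each \<open>A l\<close>, which gives the statement on sequences.

  For the semigroup, \<open>T (t (p n) + s) x\<close> stays in the target for all small \<open>s\<close>, but \<open>t (p n) + s\<close> may leave the disc of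
  radius \<open>g (p n)\<close>. Therefore \<open>x\<close> is replaced by \<open>T w x\<close>, where \<open>w\<close> is the sum of a finite set of short shifts, and
  \<open>t (p n)\<close> by \<open>z n = t (p n) - c n\<close>, where \<open>c n\<close> is the shift that moves \<open>t (p n)\<close> towards the origin inside \<open>\<Delta>\<close>.
  As \<open>T (z n) (T w x) = T (w - c n) (u n x)\<close> and \<open>T (w - c n)\<close> has dense range, the target for \<open>u n x\<close> can be
  adjusted to \<open>c n\<close>. The discs around the \<open>z n\<close> are disjoint, so their number bounds the measure from below.
\<close>

section \<open>Vectors from separated blocks\<close>

context frechet_space
begin

lemma dist_eq_dist_diff: "dist a b = dist (a - b) (0::'e)"
  using dist_translation_invariant[of "a - b" b 0] by simp

lemma dist_add_zero_le: "dist (a + b) 0 \<le> dist a 0 + dist b (0::'e)"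
proof -
  have "dist (a + b) b = dist a 0"
    using dist_eq_dist_diff[of "a + b" b] by simp
  then show ?thesis
    using dist_triangle[of "a + b" 0 b] by simp
qed

lemma dist_sum_zero_le: "dist (\<Sum>i\<in>I. a i) 0 \<le> (\<Sum>i\<in>I. dist (a i) (0::'e))"
proof (induction I rule: infinite_finite_induct)
  case (insert i I)
  then show ?case
    using dist_add_zero_le[of "a i" "sum a I"] by simp
qed simp_all

end

lemma additive_sum:
  fixes u :: "'a::ab_group_add \<Rightarrow> 'b::ab_group_add"
  assumes "\<And>a b. u (a + b) = u a + u b"
  shows "u (\<Sum>i\<in>I. a i) = (\<Sum>i\<in>I. u (a i))"
proof (induction I rule: infinite_finite_induct)
  have "u 0 = 0"
    using assms[of 0 0] by simp
  then show "\<And>I. infinite I \<Longrightarrow> u (sum a I) = (\<Sum>i\<in>I. u (a i))" "u (sum a {}) = (\<Sum>i\<in>{}. u (a i))"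
    by simp_all
qed (simp add: assms)

text \<open>Thresholds may always be raised, so the maximum of those for the three unconditional
  convergences and for the limit serves all four estimates at \<open>y\<close>.\<close>

lemma (in frechet_space) exists_threshold:
  fixes u R :: "nat \<Rightarrow> 'e \<Rightarrow> 'e" and y :: 'e
  assumes "uncond_convergent_uniformly {1..} (\<lambda>n k. if n \<le> k then u k (R (k - n) y) else 0)"
    and "uncond_convergent_uniformly {1..} (\<lambda>n k. u k (R (k + n) y))"
    and "uncond_convergent (\<lambda>n. R n y)"
    and "(\<lambda>n. u n (R n y)) \<longlonglongrightarrow> y"
    and "\<theta> > 0"
  shows "\<exists>N. (\<forall>F k. finite F \<and> F \<subseteq> {N..} \<and> 1 \<le> k \<longrightarrow>
           dist (\<Sum>n\<in>F. if n \<le> k then u k (R (k - n) y) else 0) 0 < \<theta> \<and>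
           dist (\<Sum>n\<in>F. u k (R (k + n) y)) 0 < \<theta> \<and> dist (\<Sum>n\<in>F. R n y) 0 < \<theta>) \<and>
         (\<forall>n\<ge>N. dist (u n (R n y)) y < \<theta>)"
proof -
  obtain N1 where "\<forall>F. finite F \<and> F \<subseteq> {N1..} \<longrightarrow> (\<forall>k\<in>{1..}.
      dist (\<Sum>n\<in>F. if n \<le> k then u k (R (k - n) y) else 0) 0 < \<theta>)"
    using assms(1)[unfolded uncond_convergent_uniformly_def, rule_format, OF \<open>\<theta> > 0\<close>] by (elim exE conjE)
  then have N1: "dist (\<Sum>n\<in>F. if n \<le> k then u k (R (k - n) y) else 0) 0 < \<theta>"
    if "finite F" "F \<subseteq> {N1..}" "1 \<le> k" for F k
    using that by simp
  obtain N2 where "\<forall>F. finite F \<and> F \<subseteq> {N2..} \<longrightarrow> (\<forall>k\<in>{1..}.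
      dist (\<Sum>n\<in>F. u k (R (k + n) y)) 0 < \<theta>)"
    using assms(2)[unfolded uncond_convergent_uniformly_def, rule_format, OF \<open>\<theta> > 0\<close>] by (elim exE conjE)
  then have N2: "dist (\<Sum>n\<in>F. u k (R (k + n) y)) 0 < \<theta>"
    if "finite F" "F \<subseteq> {N2..}" "1 \<le> k" for F k
    using that by simp
  obtain N3 where N3: "\<And>F. finite F \<Longrightarrow> F \<subseteq> {N3..} \<Longrightarrow> dist (\<Sum>n\<in>F. R n y) 0 < \<theta>"
    using assms(3,5) unfolding uncond_convergent_def uncond_convergent_uniformly_def
    by (metis UNIV_I)
  obtain N4 where N4: "\<And>n. n \<ge> N4 \<Longrightarrow> dist (u n (R n y)) y < \<theta>"
    using assms(4,5) unfolding lim_sequentially by metis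
  let ?N = "max (max N1 N2) (max N3 N4)"
  have "F \<subseteq> {N1..} \<and> F \<subseteq> {N2..} \<and> F \<subseteq> {N3..}" if "F \<subseteq> {?N..}" for F
    using that by auto
  then show ?thesis
    using N1 N2 N3 N4 by (intro exI[of _ ?N]) auto
qed

text \<open>The vector \<open>x\<close> is the sum of \<open>R k (y i)\<close> over all blocks
  \<open>i\<close> and all \<open>k \<in> B i\<close>. Under \<open>u n\<close> with
  \<open>n \<in> B l\<close>, the term at \<open>n\<close> is close to \<open>y l\<close>;
  \<open>bwd\<close> and \<open>fwd\<close> make the earlier and the later terms small, since their
  distances from \<open>n\<close> exceed the thresholds. \<open>N\<close> is chosen before
  \<open>B\<close>, so that sets can afterwards be built to suit it.\<close>

theorem (in frechet_space) separated_blocks_vector: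
  fixes u R :: "nat \<Rightarrow> 'e \<Rightarrow> 'e" and y :: "nat \<Rightarrow> 'e" and \<epsilon> :: "nat \<Rightarrow> real"
  assumes add: "\<And>k a b. u k (a + b) = u k a + u k b"
    and cont: "\<And>k. continuous_on UNIV (u k)"
    and \<epsilon>: "\<And>j. \<epsilon> j > 0"
    and bwd: "\<And>j. uncond_convergent_uniformly {1..}
      (\<lambda>n k. if n \<le> k then u k (R (k - n) (y j)) else 0)"
    and fwd: "\<And>j. uncond_convergent_uniformly {1..} (\<lambda>n k. u k (R (k + n) (y j)))"
    and ser: "\<And>j. uncond_convergent (\<lambda>n. R n (y j))"
    and lim: "\<And>j. (\<lambda>n. u n (R n (y j))) \<longlonglongrightarrow> y j"
  shows "\<exists>N::nat \<Rightarrow> nat. \<forall>B. (\<forall>j. \<forall>n\<in>B j. N j \<le> n) \<and>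
      (\<forall>i j. \<forall>n\<in>B i. \<forall>k\<in>B j. n < k \<longrightarrow> N i \<le> k - n \<and> N j \<le> k - n) \<and>
      (\<forall>i j. i \<noteq> j \<longrightarrow> B i \<inter> B j = {}) \<longrightarrow>
      (\<exists>x. \<forall>j. \<forall>n\<in>B j. dist (u n x) (y j) < \<epsilon> j)"
proof -
  define \<theta> where "\<theta> j = Min (\<epsilon> ` {..j}) * (1/2) ^ j / 16" for j
  \<comment> \<open>At a position of block \<open>l\<close>, block \<open>i\<close> contributes an error at most \<open>2 * \<theta> (max i l)\<close>; the factor
    \<open>(1/2) ^ i\<close> in \<open>\<theta>_le\<close> makes these errors summable over \<open>i\<close>.\<close>
  have \<theta>_pos: "\<theta> j > 0" for j
    using \<epsilon> by (simp add: \<theta>_def)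
  have \<theta>_le: "\<theta> (max i l) \<le> \<epsilon> l / 16 * (1/2) ^ i" for i l
  proof -
    have "Min (\<epsilon> ` {..max i l}) \<le> \<epsilon> l"
      by (rule Min_le) auto
    moreover have "(1/2::real) ^ max i l \<le> (1/2) ^ i"
      by (rule power_decreasing) auto
    ultimately have "Min (\<epsilon> ` {..max i l}) * (1/2) ^ max i l \<le> \<epsilon> l * (1/2) ^ i"
      using \<epsilon>[of l] by (intro mult_mono) auto
    then show ?thesis
      by (simp add: \<theta>_def)
  qed
  define good where "good i \<tau> N \<longleftrightarrow> (\<forall>F k. finite F \<and> F \<subseteq> {N..} \<and> 1 \<le> k \<longrightarrow>
           dist (\<Sum>n\<in>F. if n \<le> k then u k (R (k - n) (y i)) else 0) 0 < \<tau> \<and>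
           dist (\<Sum>n\<in>F. u k (R (k + n) (y i))) 0 < \<tau> \<and> dist (\<Sum>n\<in>F. R n (y i)) 0 < \<tau>) \<and>
         (\<forall>n\<ge>N. dist (u n (R n (y i))) (y i) < \<tau>)" for i \<tau> N
  \<comment> \<open>Thresholds are kept for every accuracy, not only for \<open>\<theta> j\<close>:
    the Cauchy argument needs a further one.\<close>
  define M where "M i \<tau> = (SOME N. good i \<tau> N)" for i \<tau>
  have ex: "\<exists>N. good i \<tau> N" if "\<tau> > 0" for i \<tau>
    unfolding good_def by (rule exists_threshold[of u R "y i", OF bwd fwd ser lim that])
  have M: "good i \<tau> (M i \<tau>)" if "\<tau> > 0" for i \<tau>
    unfolding M_def by (rule someI_ex[OF ex[OF that]])
  have goodD: "dist (\<Sum>n\<in>F. if n \<le> k then u k (R (k - n) (y i)) else 0) 0 < \<tau>"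
      "dist (\<Sum>n\<in>F. u k (R (k + n) (y i))) 0 < \<tau>" "dist (\<Sum>n\<in>F. R n (y i)) 0 < \<tau>"
    if "good i \<tau> N" "finite F" "F \<subseteq> {N..}" "1 \<le> k" for i \<tau> N F and k :: nat
    using that unfolding good_def by blast+
  have good_mono: "good i \<tau> N'" if "good i \<tau> N" "N \<le> N'" for i \<tau> and N N' :: nat
  proof -
    have sub: "{N'..} \<subseteq> {N..}"
      using that by auto
    show ?thesis
      unfolding good_def
    proof (rule conjI; intro allI impI)
      fix F and k :: nat
      assume *: "finite F \<and> F \<subseteq> {N'..} \<and> 1 \<le> k"
      then have F: "finite F" "F \<subseteq> {N..}" "1 \<le> k"
        using subset_trans[OF _ sub, of F] by blast+
      show "dist (\<Sum>n\<in>F. if n \<le> k then u k (R (k - n) (y i)) else 0) 0 < \<tau> \<and>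
          dist (\<Sum>n\<in>F. u k (R (k + n) (y i))) 0 < \<tau> \<and> dist (\<Sum>n\<in>F. R n (y i)) 0 < \<tau>"
        by (intro conjI goodD[OF that(1) F])
    next
      fix n
      assume "N' \<le> n"
      then have "N \<le> n"
        using that(2) by simp
      then show "dist (u n (R n (y i))) (y i) < \<tau>"
        using that(1) unfolding good_def by simp
    qed
  qed
  \<comment> \<open>\<open>Suc j\<close> lets only finitely many blocks meet a bounded range; the
    sum dominates the thresholds of all \<open>i \<le> j\<close> at accuracy
    \<open>\<theta> j\<close>.\<close>
  define N where "N j = Suc j + (\<Sum>i\<le>j. M i (\<theta> j))" for j
  have N_gt: "j < N j" for j
    by (simp add: N_def)
  have N_good: "good i (\<theta> j) n" if "i \<le> j" "N j \<le> n" for i j n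
  proof -
    have "M i (\<theta> j) \<le> (\<Sum>i\<le>j. M i (\<theta> j))"
      using that by (intro member_le_sum) auto
    then show ?thesis
      by (intro good_mono[OF M[OF \<theta>_pos]]) (use that in \<open>simp add: N_def\<close>)
  qed
  have "\<exists>x. \<forall>j. \<forall>n\<in>B j. dist (u n x) (y j) < \<epsilon> j"
    if B_ge: "\<And>j n. n \<in> B j \<Longrightarrow> N j \<le> n"
      and B_sep: "\<And>i j n k. n \<in> B i \<Longrightarrow> k \<in> B j \<Longrightarrow> n < k \<Longrightarrow> N i \<le> k - n \<and> N j \<le> k - n"
      and B_disj: "\<And>i j. i \<noteq> j \<Longrightarrow> B i \<inter> B j = {}" for B
  proof -

    \<comment> \<open>Convergence of the partial sums\<close>
    define X where "X K = (\<Sum>i\<le>K. \<Sum>n\<in>B i \<inter> {..K}. R n (y i))" for K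
    \<comment> \<open>Block \<open>i\<close> starts beyond \<open>i\<close>, so restricting the
      outer sum in \<open>X K\<close> to \<open>i \<le> K\<close> drops no term.\<close>
    have B_empty: "B i \<inter> {..K} = {}" if "K \<le> i" for i K
      using B_ge[of _ i] N_gt[of i] that by fastforce
    have X_alt: "X K = (\<Sum>i\<le>L. \<Sum>n\<in>B i \<inter> {..K}. R n (y i))" if "K \<le> L" for K L
      unfolding X_def using that B_empty by (intro sum.mono_neutral_left) auto
    have X_diff: "X L - X K = (\<Sum>i\<le>L. \<Sum>n\<in>B i \<inter> {K<..L}. R n (y i))" if "K \<le> L" for K L
    proof -
      have "(\<Sum>n\<in>B i \<inter> {..L}. R n (y i)) =
          (\<Sum>n\<in>B i \<inter> {..K}. R n (y i)) + (\<Sum>n\<in>B i \<inter> {K<..L}. R n (y i))" for i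
        using that by (subst sum.union_disjoint[symmetric]) (auto intro!: sum.cong)
      then show ?thesis
        by (simp add: X_alt[OF that] X_def[of L] sum.distrib)
    qed
    have small: "dist (\<Sum>n\<in>B i \<inter> {K<..L}. R n (y i)) 0 < \<tau>" if "good i \<tau> K" for i K L \<tau>
    proof -
      have "B i \<inter> {K<..L} \<subseteq> {K..}" by auto
      then show ?thesis
        by (intro goodD(3)[OF that, where k=1]) auto
    qed
    have small_\<theta>: "dist (\<Sum>n\<in>B i \<inter> {K<..L}. R n (y i)) 0 < \<theta> i" for i K L
    proof -
      have "B i \<inter> {K<..L} \<subseteq> {N i..}" using B_ge by auto
      then show ?thesis
        by (intro goodD(3)[OF N_good[of i i "N i"], where k=1]) auto
    qed
    \<comment> \<open>The first \<open>J\<close> blocks become small far out. The later ones are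
      small on every range by \<open>small_\<theta>\<close>, with summable bounds
      \<open>\<theta> i\<close>.\<close>
    have "Cauchy X"
    proof (rule metric_CauchyI)
      fix e :: real assume "e > 0"
      have "summable (\<lambda>i. \<epsilon> 0 / 16 * (1/2::real) ^ i)"
        by (intro summable_mult summable_geometric) simp
      then have "summable \<theta>"
        by (rule summable_comparison_test')
          (use \<theta>_pos \<theta>_le[of _ 0] in \<open>auto simp: less_imp_le\<close>)
      then obtain J where J: "\<And>p q. p \<ge> J \<Longrightarrow> norm (sum \<theta> {p..<q}) < e / 4"
        using \<open>e > 0\<close> unfolding summable_Cauchy by (metis zero_less_divide_iff zero_less_numeral)
      \<comment> \<open>\<open>J\<close> errors of size \<open>\<tau>\<close> add up to less than
        \<open>e / 4\<close>; the \<open>+ 1\<close> covers \<open>J = 0\<close>.\<close>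
      define \<tau> where "\<tau> = e / (4 * (real J + 1))"
      have "\<tau> > 0"
        using \<open>e > 0\<close> by (simp add: \<tau>_def)
      define K0 where "K0 = (\<Sum>i<J. M i \<tau>)"
      have K0: "good i \<tau> K0" if "i < J" for i
      proof -
        have "M i \<tau> \<le> K0"
          unfolding K0_def using that by (intro member_le_sum) auto
        then show ?thesis
          using M[OF \<open>\<tau> > 0\<close>] good_mono by blast
      qed
      have close: "dist (X L) (X K0) < e / 2" if "K0 \<le> L" for L
      proof -
        define b where "b i = dist (\<Sum>n\<in>B i \<inter> {K0<..L}. R n (y i)) 0" for i
        have "dist (X L) (X K0) \<le> (\<Sum>i\<le>L. b i)"
          unfolding dist_eq_dist_diff[of "X L"] X_diff[OF that] b_def by (rule dist_sum_zero_le)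
        also have "\<dots> \<le> (\<Sum>i\<in>{..<J} \<union> {J..<Suc L}. b i)"
          by (rule sum_mono2) (auto simp: b_def)
        also have "\<dots> = (\<Sum>i<J. b i) + (\<Sum>i\<in>{J..<Suc L}. b i)"
          by (rule sum.union_disjoint) auto
        also have "\<dots> \<le> (\<Sum>i<J. \<tau>) + (\<Sum>i\<in>{J..<Suc L}. \<theta> i)"
          using small[OF K0] small_\<theta> unfolding b_def
          by (intro add_mono sum_mono less_imp_le) auto
        also have "(\<Sum>i<J. \<tau>) < e / 4"
          using \<open>e > 0\<close> by (simp add: \<tau>_def field_simps)
        also have "(\<Sum>i\<in>{J..<Suc L}. \<theta> i) < e / 4"
          using J[of J "Suc L"] by simp
        finally show ?thesis
          by simp
      qed
      show "\<exists>M. \<forall>m\<ge>M. \<forall>n\<ge>M. dist (X m) (X n) < e"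
        by (intro exI[of _ K0] allI impI) (rule dist_triangle_half_l[OF close close])
    qed
    then obtain x where x: "X \<longlonglongrightarrow> x"
      by (auto simp: Cauchy_convergent_iff convergent_def)

    \<comment> \<open>Estimate at a position of a block\<close>
    have "dist (u n x) (y l) < \<epsilon> l" if n: "n \<in> B l" for n l
    proof -
      have n1: "1 \<le> n"
        using B_ge[OF n] N_gt[of l] by simp
      \<comment> \<open>Only a weak inequality survives the limit in \<open>K\<close>, hence the
        factor \<open>1 / 2\<close>. The terms away from \<open>n\<close> contribute at most
        \<open>\<epsilon> l / 4\<close> and the term at \<open>n\<close> at most
        \<open>\<epsilon> l / 16\<close>.\<close>
      have bound: "dist (u n (X K)) (y l) \<le> \<epsilon> l / 2" if K: "n \<le> K" for K
      proof -
        have "l \<le> K"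
          using B_ge[OF n] N_gt[of l] K by simp
        define v where "v i k = u n (R k (y i))" for i k
        define D where "D i = (\<Sum>k\<in>B i \<inter> {..<n}. v i k) + (\<Sum>k\<in>B i \<inter> {n<..K}. v i k)" for i
        have split: "(\<Sum>k\<in>B i \<inter> {..K}. v i k) = D i + (if i = l then v l n else 0)" for i
        proof -
          have "B i \<inter> {..K} = (B i \<inter> {..<n} \<union> B i \<inter> {n<..K}) \<union> (if i = l then {n} else {})"
          proof -
            have "{..K} = {..<n} \<union> {n<..K} \<union> {n}"
              using K by auto
            moreover have "B i \<inter> {n} = (if i = l then {n} else {})"
              using B_disj[of i l] n by auto
            ultimately show ?thesis
              by (simp only: Int_Un_distrib)
          qed
          moreover have "sum (v i) (B i \<inter> {..<n} \<union> B i \<inter> {n<..K}) = D i"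
            unfolding D_def by (rule sum.union_disjoint) auto
          ultimately show ?thesis
            by (auto simp: sum.union_disjoint)
        qed
        have "u n (X K) = (\<Sum>i\<le>K. \<Sum>k\<in>B i \<inter> {..K}. v i k)"
          unfolding X_def v_def additive_sum[of "u n", OF add] ..
        also have "\<dots> = (\<Sum>i\<le>K. D i) + v l n"
          using \<open>l \<le> K\<close> by (simp add: split sum.distrib)
        finally have eq: "u n (X K) - y l = (\<Sum>i\<le>K. D i) + (v l n - y l)"
          by simp
        have D_small: "dist (D i) 0 \<le> \<epsilon> l / 8 * (1/2) ^ i" for i
        proof -
          \<comment> \<open>\<open>B_sep\<close> bounds the distances from \<open>n\<close> below by
            both \<open>N i\<close> and \<open>N l\<close>, hence by \<open>N j\<close>; and
            \<open>N j\<close> is a threshold for \<open>y i\<close> because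
            \<open>i \<le> j\<close>.\<close>
          define j where "j = max i l"
          have G: "good i (\<theta> j) (N j)"
            by (rule N_good) (auto simp: j_def)
          \<comment> \<open>\<open>bwd\<close> and \<open>fwd\<close> index their terms by the
            distance from \<open>n\<close>, so the earlier and the later positions of block
            \<open>i\<close> are replaced by these distances.\<close>
          define F1 where "F1 = (\<lambda>k. n - k) ` (B i \<inter> {..<n})"
          define F2 where "F2 = (\<lambda>k. k - n) ` (B i \<inter> {n<..K})"
          have F1: "F1 \<subseteq> {N j..}" and F2: "F2 \<subseteq> {N j..}"
            using B_sep[OF _ n, of _ i] B_sep[OF n, of _ i]
            by (auto simp: F1_def F2_def j_def max_def)
          have "(\<Sum>k\<in>F1. if k \<le> n then u n (R (n - k) (y i)) else 0) = (\<Sum>k\<in>B i \<inter> {..<n}. v i k)"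
            unfolding F1_def by (subst sum.reindex) (auto intro!: inj_onI sum.cong simp: v_def)
          moreover have "(\<Sum>k\<in>F2. u n (R (n + k) (y i))) = (\<Sum>k\<in>B i \<inter> {n<..K}. v i k)"
            unfolding F2_def by (subst sum.reindex) (auto intro!: inj_onI sum.cong simp: v_def)
          moreover have "finite F1" "finite F2"
            by (auto simp: F1_def F2_def)
          ultimately have "dist (\<Sum>k\<in>B i \<inter> {..<n}. v i k) 0 < \<theta> j"
              "dist (\<Sum>k\<in>B i \<inter> {n<..K}. v i k) 0 < \<theta> j"
            using goodD(1)[OF G _ F1 n1] goodD(2)[OF G _ F2 n1] by simp_all
          then have "dist (D i) 0 \<le> 2 * \<theta> j"
            unfolding D_def
            using dist_add_zero_le[of "\<Sum>k\<in>B i \<inter> {..<n}. v i k" "\<Sum>k\<in>B i \<inter> {n<..K}. v i k"] by linarith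
          then show ?thesis
            using \<theta>_le[of i l] by (simp add: j_def)
        qed
        have "dist (u n (X K)) (y l) \<le> dist (\<Sum>i\<le>K. D i) 0 + dist (v l n - y l) 0"
          using dist_eq_dist_diff[of "u n (X K)" "y l"] dist_add_zero_le[of "\<Sum>i\<le>K. D i" "v l n - y l"]
          by (simp add: eq)
        moreover have "dist (\<Sum>i\<le>K. D i) 0 \<le> \<epsilon> l / 4"
        proof -
          have "dist (\<Sum>i\<le>K. D i) 0 \<le> (\<Sum>i\<le>K. \<epsilon> l / 8 * (1/2) ^ i)"
            using dist_sum_zero_le[of D "{..K}"] sum_mono[of "{..K}" "\<lambda>i. dist (D i) 0", OF D_small] by linarith
          also have "\<dots> = \<epsilon> l / 8 * (\<Sum>i\<le>K. (1/2) ^ i)"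
            by (simp add: sum_distrib_left)
          also have "\<dots> \<le> \<epsilon> l / 8 * 2"
          proof -
            have "(\<Sum>i\<le>K. (1/2::real) ^ i) = 2 - (1/2) ^ K"
              by (induction K) simp_all
            then show ?thesis
              using \<epsilon>[of l] by (intro mult_left_mono) simp_all
          qed
          finally show ?thesis by simp
        qed
        moreover have "dist (v l n - y l) 0 \<le> \<epsilon> l / 16"
        proof -
          have "good l (\<theta> l) n"
            using N_good B_ge n by blast
          then have "dist (v l n) (y l) < \<theta> l"
            by (auto simp: good_def v_def)
          then show ?thesis
            using \<theta>_le[of 0 l] dist_eq_dist_diff[of "v l n" "y l"] by simp
        qed
        ultimately show ?thesis
          using \<epsilon>[of l] by linarith
      qed
      have "(\<lambda>K. u n (X K)) \<longlonglongrightarrow> u n x"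
        using cont[of n] x by (rule continuous_on_tendsto_compose) auto
      then have "(\<lambda>K. dist (u n (X K)) (y l)) \<longlonglongrightarrow> dist (u n x) (y l)"
        by (intro tendsto_intros)
      then have "dist (u n x) (y l) \<le> \<epsilon> l / 2"
        by (rule LIMSEQ_le_const2) (use bound in blast)
      then show ?thesis
        using \<epsilon>[of l] by simp
    qed
    then show ?thesis by blast
  qed
  note * = this
  show ?thesis
  proof (intro exI[of _ N] allI impI, elim conjE)
    fix B
    assume "\<forall>j. \<forall>n\<in>B j. N j \<le> n"
      "\<forall>i j. \<forall>n\<in>B i. \<forall>k\<in>B j. n < k \<longrightarrow> N i \<le> k - n \<and> N j \<le> k - n"
      "\<forall>i j. i \<noteq> j \<longrightarrow> B i \<inter> B j = {}"
    then show "\<exists>x. \<forall>j. \<forall>n\<in>B j. dist (u n x) (y j) < \<epsilon> j"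
      by (intro *) simp_all
  qed
qed

section \<open>Separated sets of positive lower density\<close>

text \<open>The numbers whose exact power of two is \<open>2 ^ e l\<close> form disjoint sets
  \<open>K l\<close> of positive density, and \<open>pos\<close> spreads them out. The bound
  \<open>n div C\<close> expresses positive lower density without a limit, for every
  \<open>n\<close>.\<close>

theorem separated_sets_positive_density:
  fixes N :: "nat \<Rightarrow> nat"
  shows "\<exists>A::nat \<Rightarrow> nat set. (\<forall>l. \<forall>n\<in>A l. N l \<le> n) \<and>
    (\<forall>i j. \<forall>n\<in>A i. \<forall>k\<in>A j. n < k \<longrightarrow> N i + N j \<le> k - n) \<and>
    (\<forall>i j. i \<noteq> j \<longrightarrow> A i \<inter> A j = {}) \<and>
    (\<forall>l. \<exists>C>0. \<forall>n. n div C \<le> card (A l \<inter> {1..n}))"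
proof -
  \<comment> \<open>The added one makes \<open>e\<close> strictly increasing and \<open>w\<close>
    positive on each \<open>K l\<close>; the latter makes \<open>pos\<close> injective on their
    union.\<close>
  define N' where "N' l = Suc (N l)" for l
  define e where "e l = (\<Sum>j\<le>l. N' j)" for l
  define K where "K l = range (\<lambda>i. 2 ^ e l * (2 * i + 1 :: nat))" for l
  \<comment> \<open>The density of \<open>K l\<close> is so small compared with the gap \<open>N' l\<close> that inserting gaps of length \<open>w k\<close> on both
    sides of the \<open>k\<close>-th position stretches the index only by a bounded factor.\<close>
  define w where "w k = (\<Sum>l\<le>k. if k \<in> K l then N' l else 0)" for k
  \<comment> \<open>Intervals of radius \<open>w k\<close> are laid end to end, and
    \<open>pos k\<close> is the centre of the one with index \<open>k\<close>.\<close>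
  define pos where "pos k = 2 * (\<Sum>i<k. w i) + w k" for k
  have "strict_mono e"
    by (simp add: strict_mono_Suc_iff e_def N'_def)
  have e_ge: "N' l + l \<le> e l" for l
    by (induction l) (auto simp: e_def N'_def)
  have K_disj: "i = j" if k: "k \<in> K i" "k \<in> K j" for i j k
  proof -
    have less: "e a \<ge> e b" if eq: "2 ^ e a * (2 * p + 1) = 2 ^ e b * (2 * q + 1)" for a b and p q :: nat
    proof (rule ccontr)
      assume "\<not> e a \<ge> e b"
      then obtain d where "e b = e a + Suc d"
        by (metis less_iff_Suc_add not_le add_Suc_right)
      with eq have "2 ^ e a * (2 * p + 1) = 2 ^ e a * (2 * (2 ^ d * (2 * q + 1)))"
        by (simp only: power_add power_Suc mult.assoc)
      then have "2 * p + 1 = 2 * (2 ^ d * (2 * q + 1))"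
        by (simp only: mult_cancel_left) simp
      then show False
        by presburger
    qed
    obtain p q where "k = 2 ^ e i * (2 * p + 1)" "k = 2 ^ e j * (2 * q + 1)"
      using k unfolding K_def by blast
    then have "e i = e j"
      using less[of i p j q] less[of j q i p] by simp
    then show ?thesis
      using \<open>strict_mono e\<close> by (simp add: strict_mono_eq)
  qed
  have K_ge: "2 ^ e l \<le> k" if "k \<in> K l" for k l
    using that by (auto simp: K_def)
  have w_ge: "N' l \<le> w k" if k: "k \<in> K l" for k l
  proof -
    have "l \<le> e l"
      using e_ge[of l] by simp
    also have "e l < 2 ^ e l"
      by (rule less_exp)
    also have "\<dots> \<le> k"
      by (rule K_ge[OF k])
    finally have "(if k \<in> K l then N' l else 0) \<le> w k"
      unfolding w_def by (intro member_le_sum) auto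
    then show ?thesis
      using k by simp
  qed
  have pos_sep: "pos k + w k + w k' \<le> pos k'" if "k < k'" for k k'
  proof -
    have "(\<Sum>i<Suc k. w i) \<le> (\<Sum>i<k'. w i)"
      using that by (intro sum_mono2) auto
    then show ?thesis
      by (simp add: pos_def)
  qed
  \<comment> \<open>After interchanging the sums, block \<open>l\<close> contributes
    \<open>N' l\<close> for each element of \<open>K l\<close> up to \<open>k\<close>, hence at most
    \<open>k * N' l / 2 ^ e l\<close>. The choice of \<open>e\<close> bounds this by
    \<open>k * (1/2) ^ l\<close>, so the total weight is at most \<open>2 * k\<close>.\<close>
  have pos_le: "pos k \<le> 4 * k" for k
  proof -
    have cardK: "real (card (K l \<inter> {..k})) \<le> real k / 2 ^ e l" for l
    proof -
      have "K l \<inter> {..k} \<subseteq> (\<lambda>j. 2 ^ e l * j) ` {1..k div 2 ^ e l}"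
      proof
        fix x assume x: "x \<in> K l \<inter> {..k}"
        then obtain i where i: "x = 2 ^ e l * (2 * i + 1)"
          by (auto simp: K_def)
        then have "2 * i + 1 \<le> k div 2 ^ e l"
          using x by (simp add: less_eq_div_iff_mult_less_eq mult.commute)
        then show "x \<in> (\<lambda>j. 2 ^ e l * j) ` {1..k div 2 ^ e l}"
          unfolding i by (intro imageI) simp
      qed
      then have "card (K l \<inter> {..k}) \<le> card {1..k div 2 ^ e l}"
        by (meson card_image_le card_mono finite_atLeastAtMost finite_imageI order_trans)
      then have "real (card (K l \<inter> {..k})) \<le> real (k div 2 ^ e l)"
        by simp
      also have "\<dots> \<le> real k / 2 ^ e l"
        using of_nat_div_le_of_nat[of k "2 ^ e l", where 'a=real] by simp
      finally show ?thesis .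
    qed
    have weight: "real (N' l) / 2 ^ e l \<le> (1/2) ^ l" for l
    proof -
      have "real (N' l) * 2 ^ l \<le> 2 ^ N' l * 2 ^ l"
        by (intro mult_right_mono) (simp_all add: less_imp_le of_nat_less_two_power)
      also have "\<dots> \<le> 2 ^ e l"
        unfolding power_add[symmetric] by (intro power_increasing e_ge) simp
      finally show ?thesis
        by (simp add: field_simps)
    qed
    have "(\<Sum>i\<le>k. w i) \<le> (\<Sum>i\<le>k. \<Sum>l\<le>k. if i \<in> K l then N' l else 0)"
      unfolding w_def by (intro sum_mono sum_mono2) auto
    also have "\<dots> = (\<Sum>l\<le>k. \<Sum>i\<le>k. if i \<in> K l then N' l else 0)"
      by (rule sum.swap)
    also have "\<dots> = (\<Sum>l\<le>k. card (K l \<inter> {..k}) * N' l)"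
      by (intro sum.cong refl) (simp add: sum.inter_restrict[symmetric] Int_commute)
    finally have "real (\<Sum>i\<le>k. w i) \<le> (\<Sum>l\<le>k. real (card (K l \<inter> {..k})) * real (N' l))"
      by (simp flip: of_nat_mult of_nat_sum del: of_nat_sum of_nat_mult)
    also have "\<dots> \<le> (\<Sum>l\<le>k. real k / 2 ^ e l * real (N' l))"
      by (intro sum_mono mult_right_mono cardK) simp
    also have "\<dots> = (\<Sum>l\<le>k. real k * (real (N' l) / 2 ^ e l))"
      by simp
    also have "\<dots> \<le> (\<Sum>l\<le>k. real k * (1/2) ^ l)"
      by (intro sum_mono mult_left_mono weight) simp
    also have "\<dots> = real k * (\<Sum>l\<le>k. (1/2) ^ l)"
      by (simp add: sum_distrib_left)
    also have "\<dots> \<le> real k * 2"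
    proof -
      have "(\<Sum>l\<le>k. (1/2::real) ^ l) = 2 - (1/2) ^ k"
        by (induction k) simp_all
      then show ?thesis
        by (intro mult_left_mono) simp_all
    qed
    finally have "(\<Sum>i\<le>k. w i) \<le> 2 * k"
      by linarith
    then show ?thesis
      by (simp add: pos_def lessThan_Suc_atMost[symmetric])
  qed
  have pos_mono: "k < k'" if "pos k < pos k'" for k k'
    using that pos_sep[of k' k] by (cases k k' rule: linorder_cases) auto
  have pos_inj: "k = k'" if "pos k = pos k'" "k \<in> K i" "k' \<in> K j" for k k' i j
    using that pos_sep[of k' k] pos_sep[of k k'] w_ge[of k i] w_ge[of k' j]
    by (cases k k' rule: linorder_cases) (auto simp: N'_def)
  define A where "A l = pos ` K l" for l
  have "N l \<le> n" if "n \<in> A l" for l n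
    using that w_ge by (fastforce simp: A_def pos_def N'_def)
  moreover have "N i + N j \<le> k - n" if nk: "n \<in> A i" "k \<in> A j" "n < k" for i j n k
  proof -
    obtain a b where ab: "n = pos a" "a \<in> K i" "k = pos b" "b \<in> K j"
      using nk by (auto simp: A_def)
    then have "pos a + w a + w b \<le> pos b"
      using nk pos_mono pos_sep by blast
    then show ?thesis
      using ab w_ge[of a i] w_ge[of b j] by (simp add: N'_def)
  qed
  moreover have "A i \<inter> A j = {}" if "i \<noteq> j" for i j
    using pos_inj[of _ _ i j] K_disj[of _ i j] that by (auto simp: A_def)
  moreover have "n div 2 ^ (e l + 3) \<le> card (A l \<inter> {1..n})" for l n
  proof -
    \<comment> \<open>By \<open>pos_le\<close> and \<open>2 * i + 1 \<le> 2 * Suc i\<close>, the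
      element \<open>\<phi> i\<close> is at most \<open>4 * 2 * 2 ^ e l * Suc i\<close>, which is
      \<open>C * Suc i\<close>.\<close>
    define C :: nat where "C = 2 ^ (e l + 3)"
    define \<phi> where "\<phi> i = pos (2 ^ e l * (2 * i + 1))" for i
    have K: "2 ^ e l * (2 * i + 1) \<in> K l" for i
      by (simp add: K_def)
    have "inj_on \<phi> {..<n div C}"
    proof (rule inj_onI)
      fix i j assume "\<phi> i = \<phi> j"
      then have "2 ^ e l * (2 * i + 1) = 2 ^ e l * (2 * j + 1)"
        using pos_inj[OF _ K K] unfolding \<phi>_def by blast
      then show "i = j"
        by simp
    qed
    moreover have "\<phi> ` {..<n div C} \<subseteq> A l \<inter> {1..n}"
    proof
      fix x assume "x \<in> \<phi> ` {..<n div C}"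
      then obtain i where i: "x = \<phi> i" "Suc i \<le> n div C"
        by auto
      have "x \<le> 4 * (2 ^ e l * (2 * i + 1))"
        unfolding i \<phi>_def by (rule pos_le)
      also have "\<dots> \<le> C * Suc i"
        by (simp add: C_def power_add)
      also have "\<dots> \<le> C * (n div C)"
        using i by (intro mult_left_mono) auto
      also have "\<dots> \<le> n"
        by simp
      finally have "x \<le> n" .
      moreover have "1 \<le> x"
        using w_ge[OF K[of i]] unfolding i \<phi>_def pos_def by (simp add: N'_def)
      ultimately show "x \<in> A l \<inter> {1..n}"
        using K[of i] by (auto simp: A_def i \<phi>_def)
    qed
    ultimately have "card {..<n div C} \<le> card (A l \<inter> {1..n})"
      by (intro card_inj_on_le[of \<phi>]) auto
    then show ?thesis
      by (simp add: C_def)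
  qed
  then have "\<forall>l. \<exists>C>0. \<forall>n. n div C \<le> card (A l \<inter> {1..n})"
    by (meson zero_less_numeral zero_less_power)
  ultimately show ?thesis
    by (intro exI[of _ A] conjI) simp_all
qed

section \<open>Index sets\<close>

text \<open>For \<open>\<bar>\<theta>\<bar> \<le> pi\<close> the Cartesian inequality reads
  \<open>0 \<le> r * sin (\<alpha> - \<bar>\<theta>\<bar>)\<close>. In this form closedness and
  closure under addition are easily checked.\<close>

lemma sector_eq:
  assumes "0 < \<alpha>" "\<alpha> \<le> pi / 2"
  shows "sector \<alpha> = {z. \<bar>Im z\<bar> * cos \<alpha> \<le> Re z * sin \<alpha>}"
proof -
  have half_plane: "\<bar>Im (of_real r * cis \<theta>)\<bar> * cos \<alpha> \<le> Re (of_real r * cis \<theta>) * sin \<alpha> \<longleftrightarrow>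
      0 \<le> r * sin (\<alpha> - \<bar>\<theta>\<bar>)" if "0 \<le> r" "\<theta> \<in> {-pi<..pi}" for r \<theta>
  proof -
    have "0 \<le> sin \<bar>\<theta>\<bar>"
      using that by (intro sin_ge_zero) auto
    then have "\<bar>sin \<theta>\<bar> = sin \<bar>\<theta>\<bar>"
      by (auto simp: abs_if split: if_splits)
    moreover have "cos \<bar>\<theta>\<bar> = cos \<theta>"
      by (auto simp: abs_if)
    ultimately show ?thesis
      using that by (simp add: abs_mult sin_diff algebra_simps)
  qed
  show ?thesis
  proof (intro set_eqI iffI)
    fix z assume "z \<in> sector \<alpha>"
    then obtain r \<theta> where z: "z = of_real r * cis \<theta>" "0 \<le> r" "\<theta> \<in> {-\<alpha>..\<alpha>}"
      by (auto simp: sector_def)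
    then have "0 \<le> sin (\<alpha> - \<bar>\<theta>\<bar>)"
      using assms by (intro sin_ge_zero) auto
    then show "z \<in> {z. \<bar>Im z\<bar> * cos \<alpha> \<le> Re z * sin \<alpha>}"
      using half_plane[of r \<theta>] z assms by auto
  next
    fix z assume z: "z \<in> {z. \<bar>Im z\<bar> * cos \<alpha> \<le> Re z * sin \<alpha>}"
    show "z \<in> sector \<alpha>"
    proof (cases "z = 0")
      case True
      then show ?thesis
        using assms by (auto simp: sector_def intro!: exI[of _ 0])
    next
      case False
      have polar: "z = of_real (cmod z) * cis (Arg z)"
        using False by (simp add: cis_Arg sgn_eq)
      have "0 \<le> cmod z * sin (\<alpha> - \<bar>Arg z\<bar>)"
        using half_plane[of "cmod z" "Arg z"] Arg_bounded[of z] z polar by auto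
      then have "0 \<le> sin (\<alpha> - \<bar>Arg z\<bar>)"
        using False by (simp add: zero_le_mult_iff)
      moreover have "sin (\<alpha> - \<bar>Arg z\<bar>) < 0" if "\<alpha> < \<bar>Arg z\<bar>"
        using that assms Arg_bounded[of z] sin_gt_zero[of "\<bar>Arg z\<bar> - \<alpha>"] sin_minus[of "\<bar>Arg z\<bar> - \<alpha>"]
        by auto
      ultimately have "\<bar>Arg z\<bar> \<le> \<alpha>"
        by force
      then show ?thesis
        unfolding sector_def using polar
        by (intro CollectI exI[of _ "cmod z"] exI[of _ "Arg z"]) auto
    qed
  qed
qed

lemma nonneg_reals_eq: "complex_of_real ` {0..} = {z. Im z = 0 \<and> 0 \<le> Re z}"
  by (auto simp: complex_eq_iff image_iff)

lemma index_set_cases [consumes 1, case_names nonneg reals complex sector]: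
  assumes "index_set \<Delta>"
  obtains "\<Delta> = {z. Im z = 0 \<and> 0 \<le> Re z}" | "\<Delta> = {z. Im z = 0}" | "\<Delta> = UNIV"
    | \<alpha> where "0 < \<alpha>" "\<alpha> \<le> pi / 2" "\<Delta> = {z. \<bar>Im z\<bar> * cos \<alpha> \<le> Re z * sin \<alpha>}"
proof -
  have "\<real> = {z. Im z = 0}"
    by (auto simp: complex_is_Real_iff)
  then show ?thesis
    using assms that unfolding index_set_def nonneg_reals_eq by (metis sector_eq)
qed

lemma index_set_closed:
  assumes "index_set \<Delta>"
  shows "closed \<Delta>"
  using assms
  by (cases rule: index_set_cases)
    (auto intro!: closed_Collect_conj closed_Collect_eq closed_Collect_le continuous_intros)

lemma index_set_zero: "index_set \<Delta> \<Longrightarrow> 0 \<in> \<Delta>"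
  by (cases rule: index_set_cases) auto

lemma index_set_add:
  assumes "index_set \<Delta>" "s \<in> \<Delta>" "t \<in> \<Delta>"
  shows "s + t \<in> \<Delta>"
  using assms(1)
proof (cases rule: index_set_cases)
  case (sector \<alpha>)
  have "0 \<le> cos \<alpha>"
    using sector by (intro cos_ge_zero) auto
  then have "\<bar>Im s + Im t\<bar> * cos \<alpha> \<le> \<bar>Im s\<bar> * cos \<alpha> + \<bar>Im t\<bar> * cos \<alpha>"
    by (simp add: mult_right_mono flip: distrib_right)
  then show ?thesis
    using assms sector by (simp add: distrib_right)
qed (use assms in auto)

lemma index_set_sum:
  assumes "index_set \<Delta>" "\<And>i. i \<in> I \<Longrightarrow> s i \<in> \<Delta>"
  shows "(\<Sum>i\<in>I. s i) \<in> \<Delta>"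
  using assms(2)
  by (induction I rule: infinite_finite_induct)
    (auto intro: index_set_add[OF assms(1)] index_set_zero[OF assms(1)])

text \<open>The square of the left side is at most
  \<open>(cmod t)\<^sup>2 - \<sigma> * cmod t + \<sigma>\<^sup>2\<close>. As
  \<open>\<sigma> \<le> cmod t / 2\<close>, this is at most
  \<open>(cmod t)\<^sup>2 - \<sigma> * cmod t / 2\<close>, which lies below the square of the right
  side.\<close>

lemma cmod_diff_le_retreat:
  assumes "cmod w = 1" "0 < \<sigma>" "2 * \<sigma> \<le> cmod t" "cmod t / 2 \<le> Re (t * cnj w)"
  shows "cmod (t - of_real \<sigma> * w) \<le> cmod t - \<sigma> / 4"
proof (rule power2_le_imp_le)
  have w: "(Re w)\<^sup>2 + (Im w)\<^sup>2 = 1"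
    using assms(1) by (metis cmod_power2 one_power2)
  have "(cmod (t - of_real \<sigma> * w))\<^sup>2 =
      (cmod t)\<^sup>2 - 2 * \<sigma> * Re (t * cnj w) + \<sigma>\<^sup>2 * ((Re w)\<^sup>2 + (Im w)\<^sup>2)"
    unfolding cmod_power2 by (simp add: power2_eq_square algebra_simps)
  moreover have "\<sigma> * cmod t \<le> 2 * \<sigma> * Re (t * cnj w)"
    using mult_left_mono[OF assms(4), of \<sigma>] assms(2) by simp
  moreover have "2 * \<sigma>\<^sup>2 \<le> \<sigma> * cmod t"
    using mult_left_mono[OF assms(3), of \<sigma>] assms(2) by (simp add: power2_eq_square)
  moreover have "(cmod t - \<sigma> / 4)\<^sup>2 = (cmod t)\<^sup>2 - \<sigma> * cmod t / 2 + \<sigma>\<^sup>2 / 16"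
    by (simp add: power2_eq_square algebra_simps)
  ultimately show "(cmod (t - of_real \<sigma> * w))\<^sup>2 \<le> (cmod t - \<sigma> / 4)\<^sup>2"
    unfolding w using zero_le_power2[of \<sigma>] by linarith
  show "0 \<le> cmod t - \<sigma> / 4"
    using assms by simp
qed

text \<open>Write \<open>t\<close> as \<open>a + b * cis \<alpha>\<close> with
  \<open>a, b \<ge> 0\<close>. Since \<open>cmod t \<le> a + b\<close>, the larger coefficient is at
  least \<open>cmod t / 2 \<ge> \<sigma>\<close>, so \<open>\<sigma>\<close> can be subtracted from
  it without leaving the upper half of the sector.\<close>

lemma sector_retreat:
  assumes \<alpha>: "0 < \<alpha>" "\<alpha> \<le> pi / 2" and \<sigma>: "0 < \<sigma>" "2 * \<sigma> \<le> cmod t"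
    and t: "Im t * cos \<alpha> \<le> Re t * sin \<alpha>" "0 \<le> Im t"
  shows "\<exists>w\<in>{1, cis \<alpha>}. cmod t / 2 \<le> Re (t * cnj w) \<and>
    0 \<le> Im (t - of_real \<sigma> * w) \<and>
    Im (t - of_real \<sigma> * w) * cos \<alpha> \<le> Re (t - of_real \<sigma> * w) * sin \<alpha>"
proof -
  have sin: "0 < sin \<alpha>"
    using \<alpha> by (intro sin_gt_zero) auto
  have cos: "0 \<le> cos \<alpha>"
    using \<alpha> by (intro cos_ge_zero) auto
  define b where "b = Im t / sin \<alpha>"
  define a where "a = Re t - b * cos \<alpha>"
  have t_eq: "Im t = b * sin \<alpha>" "Re t = a + b * cos \<alpha>"
    using sin by (auto simp: a_def b_def)
  have "0 \<le> b"
    using t sin by (simp add: b_def)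
  have "0 \<le> a * sin \<alpha>"
    using t t_eq by (simp add: algebra_simps)
  then have "0 \<le> a"
    using sin by (simp add: zero_le_mult_iff)
  have "t = of_real a + of_real b * cis \<alpha>"
    using t_eq by (simp add: complex_eq_iff)
  then have "cmod t \<le> a + b"
    using norm_triangle_ineq[of "of_real a" "of_real b * cis \<alpha>"] \<open>0 \<le> a\<close> \<open>0 \<le> b\<close>
    by (simp add: norm_mult)
  have one: "sin \<alpha> * sin \<alpha> + cos \<alpha> * cos \<alpha> = 1"
    using sin_cos_squared_add[of \<alpha>] by (simp add: power2_eq_square)
  show ?thesis
  proof (cases "b \<le> a")
    case True
    then have "cmod t / 2 \<le> a" "\<sigma> \<le> a"
      using \<open>cmod t \<le> a + b\<close> \<sigma> by auto
    moreover have "\<sigma> * sin \<alpha> \<le> a * sin \<alpha>"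
      using \<open>\<sigma> \<le> a\<close> sin by simp
    ultimately show ?thesis
      using t t_eq \<open>0 \<le> b\<close> cos by (intro bexI[of _ 1]) (auto simp: algebra_simps add_increasing2)
  next
    case False
    then have b: "cmod t / 2 \<le> b" "\<sigma> \<le> b"
      using \<open>cmod t \<le> a + b\<close> \<sigma> by auto
    have "Re (t * cnj (cis \<alpha>)) = (a + b * cos \<alpha>) * cos \<alpha> + b * sin \<alpha> * sin \<alpha>"
      by (simp add: t_eq)
    also have "\<dots> = a * cos \<alpha> + b"
      using one by algebra
    finally have "Re (t * cnj (cis \<alpha>)) = a * cos \<alpha> + b" .
    moreover have "\<sigma> * sin \<alpha> \<le> b * sin \<alpha>"
      using b sin by simp
    moreover have "0 \<le> a * sin \<alpha>" "0 \<le> a * cos \<alpha>"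
      using \<open>0 \<le> a\<close> sin cos by simp_all
    ultimately show ?thesis
      using b by (intro bexI[of _ "cis \<alpha>"]) (auto simp: t_eq algebra_simps)
  qed
qed

text \<open>
  The translates \<open>t + initial_part \<Delta> \<eta>\<close> stick out of \<open>initial_part \<Delta> \<bar>t\<bar>\<close>. Moving \<open>t\<close> back by one of finitely many
  elements of \<open>\<Delta>\<close> repairs this; a single element does not suffice near the boundary rays of a sector.
\<close>

lemma index_set_retreat:
  assumes "index_set \<Delta>" "0 < \<sigma>"
  shows "\<exists>G. finite G \<and> G \<subseteq> \<Delta> \<and> (\<forall>s\<in>G. cmod s \<le> \<sigma>) \<and>
    (\<forall>t\<in>\<Delta>. 2 * \<sigma> \<le> cmod t \<longrightarrow> (\<exists>s\<in>G. t - s \<in> \<Delta> \<and> cmod (t - s) \<le> cmod t - \<sigma> / 4))"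
proof -
  \<comment> \<open>It suffices to find finitely many unit directions such that every
    \<open>t\<close> far from 0 has a large component along one of them and may be moved back along
    it inside \<open>\<Delta>\<close>.\<close>
  have *: ?thesis if W: "finite W" "\<And>w. w \<in> W \<Longrightarrow> cmod w = 1 \<and> of_real \<sigma> * w \<in> \<Delta>"
    and ex: "\<And>t. t \<in> \<Delta> \<Longrightarrow> 2 * \<sigma> \<le> cmod t \<Longrightarrow>
      \<exists>w\<in>W. cmod t / 2 \<le> Re (t * cnj w) \<and> t - of_real \<sigma> * w \<in> \<Delta>" for W
  proof (intro exI[of _ "(\<lambda>w. of_real \<sigma> * w) ` W"] conjI ballI impI)
    fix t assume t: "t \<in> \<Delta>" "2 * \<sigma> \<le> cmod t"
    then obtain w where "w \<in> W" "cmod t / 2 \<le> Re (t * cnj w)" "t - of_real \<sigma> * w \<in> \<Delta>"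
      using ex by blast
    then show "\<exists>s\<in>(\<lambda>w. of_real \<sigma> * w) ` W. t - s \<in> \<Delta> \<and> cmod (t - s) \<le> cmod t - \<sigma> / 4"
      using cmod_diff_le_retreat[of w \<sigma> t] W(2) assms(2) t by blast
  qed (use W assms in \<open>auto simp: norm_mult\<close>)
  from assms(1) show ?thesis
  proof (cases rule: index_set_cases)
    case nonneg
    show ?thesis
    proof (rule *[of "{1}"])
      fix t assume "t \<in> \<Delta>" "2 * \<sigma> \<le> cmod t"
      moreover from this have "cmod t = Re t"
        using nonneg by (simp add: cmod_eq_Re)
      ultimately show "\<exists>w\<in>{1}. cmod t / 2 \<le> Re (t * cnj w) \<and> t - of_real \<sigma> * w \<in> \<Delta>"
        using nonneg assms by simp
    qed (use nonneg assms in auto)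
  next
    case reals
    show ?thesis
    proof (rule *[of "{1, -1}"])
      fix t assume "t \<in> \<Delta>" "2 * \<sigma> \<le> cmod t"
      moreover from this have "cmod t = \<bar>Re t\<bar>"
        using reals by (simp add: cmod_eq_Re)
      ultimately show "\<exists>w\<in>{1, -1}. cmod t / 2 \<le> Re (t * cnj w) \<and> t - of_real \<sigma> * w \<in> \<Delta>"
        using reals assms by auto
    qed (use reals assms in auto)
  next
    \<comment> \<open>As \<open>cmod t \<le> \<bar>Re t\<bar> + \<bar>Im t\<bar>\<close>, one of the
      four axis directions carries at least half of the modulus.\<close>
    case complex
    show ?thesis
    proof (rule *[of "{1, -1, \<i>, -\<i>}"])
      fix t assume "t \<in> \<Delta>" "2 * \<sigma> \<le> cmod t"
      then show "\<exists>w\<in>{1, -1, \<i>, -\<i>}. cmod t / 2 \<le> Re (t * cnj w) \<and> t - of_real \<sigma> * w \<in> \<Delta>"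
        using cmod_le[of t] complex by auto
    qed (use complex in auto)
  next
    case (sector \<alpha>)
    have "0 < sin \<alpha>"
      using sector by (intro sin_gt_zero) auto
    have "0 \<le> cos \<alpha>"
      using sector by (intro cos_ge_zero) auto
    show ?thesis
    proof (rule *[of "{1, cis \<alpha>, cis (-\<alpha>)}"])
      fix t assume t: "t \<in> \<Delta>" "2 * \<sigma> \<le> cmod t"
      show "\<exists>w\<in>{1, cis \<alpha>, cis (-\<alpha>)}. cmod t / 2 \<le> Re (t * cnj w) \<and> t - of_real \<sigma> * w \<in> \<Delta>"
      proof (cases "0 \<le> Im t")
        case True
        then have "\<exists>w\<in>{1, cis \<alpha>}. cmod t / 2 \<le> Re (t * cnj w) \<and>
            0 \<le> Im (t - of_real \<sigma> * w) \<and>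
            Im (t - of_real \<sigma> * w) * cos \<alpha> \<le> Re (t - of_real \<sigma> * w) * sin \<alpha>"
          using sector_retreat[of \<alpha> \<sigma> t] sector assms t by auto
        then show ?thesis
          unfolding sector by auto
      next
        case False
        \<comment> \<open>The sector is symmetric under conjugation, which turns
          \<open>cis \<alpha>\<close> into \<open>cis (-\<alpha>)\<close>.\<close>
        then have "\<exists>w\<in>{1, cis \<alpha>}. cmod (cnj t) / 2 \<le> Re (cnj t * cnj w) \<and>
            0 \<le> Im (cnj t - of_real \<sigma> * w) \<and>
            Im (cnj t - of_real \<sigma> * w) * cos \<alpha> \<le> Re (cnj t - of_real \<sigma> * w) * sin \<alpha>"
          using sector_retreat[of \<alpha> \<sigma> "cnj t"] sector assms t by auto
        then show ?thesis
          unfolding sector by auto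
      qed
    next
      fix w assume "w \<in> {1, cis \<alpha>, cis (-\<alpha>)}"
      then show "cmod w = 1 \<and> of_real \<sigma> * w \<in> \<Delta>"
        using \<open>0 < sin \<alpha>\<close> \<open>0 \<le> cos \<alpha>\<close> assms by (auto simp: sector abs_mult)
    qed simp
  qed
qed

text \<open>The translates \<open>p + K\<close> lie in disjoint balls of radius
  \<open>\<eta>\<close>, have equal measure and are contained in \<open>A\<close>.\<close>

lemma measure_packing_le:
  fixes K A :: "'a::euclidean_space set"
  assumes "finite P" "K \<in> lmeasurable" "A \<in> lmeasurable"
    and K: "K \<subseteq> cball 0 \<eta>"
    and sep: "\<And>p q. p \<in> P \<Longrightarrow> q \<in> P \<Longrightarrow> p \<noteq> q \<Longrightarrow> 2 * \<eta> < dist p q"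
    and sub: "\<And>p s. p \<in> P \<Longrightarrow> s \<in> K \<Longrightarrow> p + s \<in> A"
  shows "real (card P) * measure lebesgue K \<le> measure lebesgue A"
proof -
  have lmeasurable_translate: "(+) p ` K \<in> lmeasurable" for p
    using assms(2) by (rule measurable_translation)
  have disj: "disjoint_family_on (\<lambda>p. (+) p ` K) P"
    unfolding disjoint_family_on_def
  proof (intro ballI impI equals0I)
    fix p q x assume pq: "p \<in> P" "q \<in> P" "p \<noteq> q" and x: "x \<in> (+) p ` K \<inter> (+) q ` K"
    obtain a b where "a \<in> K" "b \<in> K" "x = p + a" "x = q + b"
      using x by auto
    moreover from this have "norm a \<le> \<eta>" "norm b \<le> \<eta>"
      using K by auto
    moreover have "p - q = b - a"
      using \<open>x = p + a\<close> \<open>x = q + b\<close> by (simp add: algebra_simps)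
    ultimately have "dist p q \<le> 2 * \<eta>"
      using norm_triangle_ineq4[of b a] by (simp add: dist_norm)
    then show False
      using sep[OF pq] by simp
  qed
  have "real (card P) * measure lebesgue K = (\<Sum>p\<in>P. measure lebesgue ((+) p ` K))"
    by (simp add: measure_translation)
  also have "\<dots> = measure lebesgue (\<Union>p\<in>P. (+) p ` K)"
    using assms(1) disj fmeasurableD[OF lmeasurable_translate] fmeasurableD2[OF lmeasurable_translate]
    by (intro measure_finite_Union[symmetric]) auto
  also have "\<dots> \<le> measure lebesgue A"
  proof (rule measure_mono_fmeasurable)
    show "(\<Union>p\<in>P. (+) p ` K) \<in> sets lebesgue"
      using assms(1) fmeasurableD[OF lmeasurable_translate] by (intro sets.finite_UN)
  qed (use assms(3) sub in auto)
  finally show ?thesis .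
qed

lemma index_set_subset_reals:
  assumes "index_set \<Delta>" "\<Delta> \<subseteq> \<real>"
  shows "\<Delta> = {z. Im z = 0 \<and> 0 \<le> Re z} \<or> \<Delta> = {z. Im z = 0}"
  using assms(1)
proof (cases rule: index_set_cases)
  case complex
  then have "\<i> \<in> \<real>"
    using assms(2) by blast
  then show ?thesis
    by (simp add: complex_is_Real_iff)
next
  case (sector \<alpha>)
  have sin: "0 < sin \<alpha>"
    using sector by (intro sin_gt_zero) auto
  have "cis \<alpha> \<in> \<Delta>"
    using sin by (simp add: sector)
  then show ?thesis
    using assms(2) sin by (auto simp: complex_is_Real_iff)
qed auto

lemma index_set_interior_initial_part:
  assumes "index_set \<Delta>" "\<not> \<Delta> \<subseteq> \<real>" "0 < \<eta>"
  shows "\<exists>U. open U \<and> U \<noteq> {} \<and> U \<subseteq> initial_part \<Delta> \<eta>"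
  using assms(1)
proof (cases rule: index_set_cases)
  case complex
  then show ?thesis
    using assms(3) by (intro exI[of _ "ball 0 \<eta>"]) (auto simp: initial_part_def)
next
  case (sector \<alpha>)
  have sin: "0 < sin \<alpha>"
    using sector by (intro sin_gt_zero) auto
  define U where "U = {z. \<bar>Im z\<bar> * cos \<alpha> < Re z * sin \<alpha>} \<inter> ball 0 \<eta>"
  have "open U"
    unfolding U_def by (intro open_Int open_Collect_less continuous_intros) auto
  moreover have "of_real (\<eta> / 2) \<in> U"
    using sin assms(3) by (simp add: U_def)
  moreover have "U \<subseteq> initial_part \<Delta> \<eta>"
    by (auto simp: U_def initial_part_def sector)
  ultimately show ?thesis
    by blast
qed (use assms(2) in \<open>auto simp: complex_is_Real_iff\<close>)

lemma measure_lebesgue_pos: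
  fixes K :: "'a::euclidean_space set"
  assumes "K \<in> lmeasurable" "open U" "U \<noteq> {}" "U \<subseteq> K"
  shows "0 < measure lebesgue K"
proof -
  have "\<not> negligible K"
    using assms open_not_negligible negligible_subset by blast
  then show ?thesis
    using negligible_iff_measure[of K] assms(1) measure_nonneg[of lebesgue K] by (simp add: less_le)
qed

text \<open>Turns an image into a preimage under a continuous map, for which Borel measurability is
  inherited.\<close>

lemma Re_image_real_subset:
  assumes "A \<subseteq> \<real>"
  shows "Re ` A = of_real -` A"
  using assms by (force simp: complex_is_Real_iff complex_eq_iff image_iff)

text \<open>These are bounded Borel sets, since \<open>\<Delta>\<close> is closed. The open set
  \<open>U\<close> is meant to cut out the return times of an orbit.\<close>

lemma lmeasurable_index_part:
  assumes "index_set \<Delta>" "open U"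
  shows "\<not> \<Delta> \<subseteq> \<real> \<Longrightarrow> \<Delta> \<inter> U \<inter> initial_part \<Delta> R \<in> lmeasurable"
    and "\<Delta> \<subseteq> \<real> \<Longrightarrow> Re ` (\<Delta> \<inter> U \<inter> initial_part \<Delta> R) \<in> lmeasurable"
proof -
  have eq: "\<Delta> \<inter> U \<inter> initial_part \<Delta> R = \<Delta> \<inter> U \<inter> cball 0 R"
    by (auto simp: initial_part_def)
  have borel: "\<Delta> \<inter> U \<inter> initial_part \<Delta> R \<in> sets borel"
    unfolding eq using assms index_set_closed by (intro sets.Int) auto
  then show "\<Delta> \<inter> U \<inter> initial_part \<Delta> R \<in> lmeasurable"
    by (intro bounded_set_imp_lmeasurable) (auto simp: eq intro: bounded_subset[OF bounded_cball])
  assume "\<Delta> \<subseteq> \<real>"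
  then have "Re ` (\<Delta> \<inter> U \<inter> initial_part \<Delta> R) = of_real -` (\<Delta> \<inter> U \<inter> initial_part \<Delta> R)"
    by (intro Re_image_real_subset) auto
  moreover have "of_real -` (\<Delta> \<inter> U \<inter> initial_part \<Delta> R) \<in> sets borel"
    using measurable_sets[OF borel_measurable_continuous_onI[OF continuous_on_of_real_id] borel] by simp
  moreover have "bounded (Re ` (\<Delta> \<inter> U \<inter> initial_part \<Delta> R))"
    by (rule bounded_linear_image[OF _ bounded_linear_Re]) (auto simp: eq intro: bounded_subset[OF bounded_cball])
  ultimately show "Re ` (\<Delta> \<inter> U \<inter> initial_part \<Delta> R) \<in> lmeasurable"
    by (intro bounded_set_imp_lmeasurable) auto
qed

text \<open>The translates \<open>p + initial_part \<Delta> \<eta>\<close> stay in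
  \<open>\<Delta>\<close> because it is closed under addition. If \<open>\<Delta>\<close> is real,
  the packing is transported to the line by \<open>Re\<close>, which is isometric on
  \<open>\<Delta>\<close>.\<close>

lemma index_measure_packing:
  assumes "index_set \<Delta>" "open U" "0 < \<eta>" "finite P" "P \<subseteq> \<Delta>"
    and sep: "\<And>p q. p \<in> P \<Longrightarrow> q \<in> P \<Longrightarrow> p \<noteq> q \<Longrightarrow> 2 * \<eta> < dist p q"
    and sub: "\<And>p s. p \<in> P \<Longrightarrow> s \<in> \<Delta> \<Longrightarrow> cmod s \<le> \<eta> \<Longrightarrow> p + s \<in> U \<and> cmod (p + s) \<le> R"
  shows "real (card P) * index_measure \<Delta> (initial_part \<Delta> \<eta>) \<le>
    index_measure \<Delta> (\<Delta> \<inter> U \<inter> initial_part \<Delta> R)"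
proof -
  have K_eq: "initial_part \<Delta> \<eta> = \<Delta> \<inter> UNIV \<inter> initial_part \<Delta> \<eta>"
    by (auto simp: initial_part_def)
  have sub': "p + s \<in> \<Delta> \<inter> U \<inter> initial_part \<Delta> R" if "p \<in> P" "s \<in> initial_part \<Delta> \<eta>" for p s
    using that sub[of p s] assms(5) index_set_add[OF assms(1)] by (auto simp: initial_part_def)
  show ?thesis
  proof (cases "\<Delta> \<subseteq> \<real>")
    case False
    have "real (card P) * measure lebesgue (initial_part \<Delta> \<eta>) \<le>
        measure lebesgue (\<Delta> \<inter> U \<inter> initial_part \<Delta> R)"
    proof (rule measure_packing_le)
      show "initial_part \<Delta> \<eta> \<in> lmeasurable"
        using lmeasurable_index_part(1)[OF assms(1) open_UNIV False, of \<eta>] K_eq by simp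
      show "initial_part \<Delta> \<eta> \<subseteq> cball 0 \<eta>"
        by (auto simp: initial_part_def)
    qed (use False assms sub' lmeasurable_index_part(1) in auto)
    then show ?thesis
      using False by (simp add: index_measure_def)
  next
    case True
    have dist_Re: "dist (Re p) (Re q) = dist p q" if "p \<in> \<Delta>" "q \<in> \<Delta>" for p q
    proof -
      have "p \<in> \<real>" "q \<in> \<real>"
        using that True by auto
      then have "Im (p - q) = 0"
        by (simp add: complex_is_Real_iff)
      then have "cmod (p - q) = \<bar>Re (p - q)\<bar>"
        by (rule cmod_eq_Re)
      then show ?thesis
        by (simp add: dist_norm)
    qed
    have "inj_on Re P"
      using dist_Re assms(5) by (intro inj_onI) (metis dist_eq_0_iff subsetD)
    have "real (card (Re ` P)) * measure lebesgue (Re ` initial_part \<Delta> \<eta>) \<le>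
        measure lebesgue (Re ` (\<Delta> \<inter> U \<inter> initial_part \<Delta> R))"
    proof (rule measure_packing_le)
      show "Re ` initial_part \<Delta> \<eta> \<in> lmeasurable"
        using lmeasurable_index_part(2)[OF assms(1) open_UNIV True, of \<eta>] K_eq by simp
      show "Re ` initial_part \<Delta> \<eta> \<subseteq> cball 0 \<eta>"
        using order_trans[OF abs_Re_le_cmod] by (auto simp: initial_part_def)
      show "p + s \<in> Re ` (\<Delta> \<inter> U \<inter> initial_part \<Delta> R)"
        if "p \<in> Re ` P" "s \<in> Re ` initial_part \<Delta> \<eta>" for p s
        using that sub' by (force simp flip: plus_complex.sel)
      show "2 * \<eta> < dist p q" if pq: "p \<in> Re ` P" "q \<in> Re ` P" "p \<noteq> q" for p q
      proof -
        obtain x y where "x \<in> P" "y \<in> P" "p = Re x" "q = Re y"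
          using pq by blast
        moreover from this have "2 * \<eta> < dist x y"
          using pq by (intro sep) auto
        ultimately show ?thesis
          using dist_Re[of x y] subsetD[OF assms(5)] by simp
      qed
    qed (use True assms lmeasurable_index_part(2) in auto)
    then show ?thesis
      using True card_image[OF \<open>inj_on Re P\<close>] by (simp add: index_measure_def)
  qed
qed

lemma index_measure_initial_part_pos:
  assumes "index_set \<Delta>" "0 < \<eta>"
  shows "0 < index_measure \<Delta> (initial_part \<Delta> \<eta>)"
proof -
  have K_eq: "initial_part \<Delta> \<eta> = \<Delta> \<inter> UNIV \<inter> initial_part \<Delta> \<eta>"
    by (auto simp: initial_part_def)
  show ?thesis
  proof (cases "\<Delta> \<subseteq> \<real>")
    case False
    then have "initial_part \<Delta> \<eta> \<in> lmeasurable"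
      using lmeasurable_index_part(1)[OF assms(1) open_UNIV, of \<eta>] K_eq by simp
    then show ?thesis
      using False index_set_interior_initial_part[OF assms(1) False assms(2)] measure_lebesgue_pos
      by (auto simp: index_measure_def)
  next
    case True
    then have "Re ` initial_part \<Delta> \<eta> \<in> lmeasurable"
      using lmeasurable_index_part(2)[OF assms(1) open_UNIV, of \<eta>] K_eq by simp
    moreover have "{0<..<\<eta>} \<subseteq> Re ` initial_part \<Delta> \<eta>"
    proof
      fix r assume "r \<in> {0<..<\<eta>}"
      then have "of_real r \<in> initial_part \<Delta> \<eta>"
        using index_set_subset_reals[OF assms(1) True] by (auto simp: initial_part_def)
      then show "r \<in> Re ` initial_part \<Delta> \<eta>"
        by (metis Re_complex_of_real imageI)
    qed
    moreover have "{0<..<\<eta>} \<noteq> {}"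
      using assms(2) by simp
    ultimately show ?thesis
      using True measure_lebesgue_pos[of _ "{0<..<\<eta>}"] by (simp add: index_measure_def)
  qed
qed

section \<open>Orbits near prescribed targets\<close>

text \<open>Balls of radius \<open>1 / Suc b\<close> about the points of a countable dense set, with
  centre and radius coded by one number. Small open sets inside a given one suffice, since an orbit
  only has to visit that set.\<close>

lemma separable_countable_base:
  assumes "separable TYPE('e::metric_space)"
  shows "\<exists>V :: nat \<Rightarrow> 'e set. (\<forall>l. open (V l) \<and> V l \<noteq> {}) \<and>
    (\<forall>U. open U \<and> U \<noteq> {} \<longrightarrow> (\<exists>l. V l \<subseteq> U))"
proof -
  obtain D :: "'e set" where D: "countable D" "closure D = UNIV"
    using assms by (auto simp: separable_def)
  have "D \<noteq> {}"
    using D by auto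
  define V where "V l = (case prod_decode l of (a, b) \<Rightarrow> ball (from_nat_into D a) (1 / Suc b))" for l
  have "\<exists>l. V l \<subseteq> U" if U: "open U" "x \<in> U" for U x
  proof -
    obtain e where e: "0 < e" "ball x e \<subseteq> U"
      using U by (meson openE)
    obtain d where d: "d \<in> D" "dist d x < e / 2"
      using D e closure_approachable[of x D] by (metis UNIV_I half_gt_zero)
    obtain b where b: "1 / Suc b < e / 2"
      using e nat_approx_posE[of "e / 2"] by auto
    obtain a where "from_nat_into D a = d"
      using from_nat_into_surj[OF D(1) d(1)] by blast
    then have "V (prod_encode (a, b)) = ball d (1 / Suc b)"
      by (simp add: V_def)
    also have "\<dots> \<subseteq> ball x e"
    proof
      fix z assume "z \<in> ball d (1 / Suc b)"
      then have "dist d z < e / 2"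
        using b by simp
      then show "z \<in> ball x e"
        using d(2) dist_triangle_half_r[of d x e z] by simp
    qed
    finally show ?thesis
      using e by blast
  qed
  moreover have "open (V l) \<and> V l \<noteq> {}" for l
    by (auto simp: V_def split: prod.split)
  ultimately show ?thesis
    by (intro exI[of _ V]) blast
qed

lemma closure_range_comp:
  fixes g :: "'b::topological_space \<Rightarrow> 'c::topological_space"
  assumes "closure (range f) = UNIV" "closure (range g) = UNIV" "continuous_on UNIV g"
  shows "closure (range (g \<circ> f)) = UNIV"
proof -
  have "g ` closure (range f) \<subseteq> closure (range (g \<circ> f))"
    using assms by (intro image_closure_subset) (auto intro: closure_subset[THEN subsetD])
  then have "closure (range g) \<subseteq> closure (range (g \<circ> f))"
    using assms by (intro closure_minimal) auto
  then show ?thesis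
    using assms by auto
qed

text \<open>
  This Baire category argument takes the place of local equicontinuity: it does not control \<open>T s\<close> near a
  prescribed point, but the targets of the construction may be moved anyway.
\<close>

lemma (in C0_semigroup) exists_uniform_neighbourhood:
  assumes "open V" "V \<noteq> {}"
  shows "\<exists>U \<eta>. open U \<and> U \<noteq> {} \<and> 0 < \<eta> \<and> (\<forall>s\<in>\<Delta>. \<forall>x\<in>U. cmod s \<le> \<eta> \<longrightarrow> T s x \<in> V)"
proof -
  obtain v r where r: "0 < r" "cball v r \<subseteq> V"
    using assms open_contains_cball by blast
  \<comment> \<open>The closed ball makes every \<open>C n\<close> closed; continuity of the orbits
    at 0 puts each point of the open ball into some \<open>C n\<close>, so one of them has
    interior.\<close>
  define C where "C n = {x. \<forall>s\<in>\<Delta>. cmod s \<le> 1 / Suc n \<longrightarrow> T s x \<in> cball v r}" for n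
  have "closed (C n)" for n
  proof -
    have "C n = (\<Inter>s\<in>\<Delta> \<inter> {s. cmod s \<le> 1 / Suc n}. T s -` cball v r)"
      by (auto simp: C_def)
    then show ?thesis
      using continuous_T by (auto intro!: closed_INT closed_vimage)
  qed
  have "ball v r \<subseteq> (\<Union>n. C n)"
  proof
    fix x assume "x \<in> ball v r"
    then have "0 < r - dist v x"
      by simp
    then obtain d where d: "0 < d" "\<And>s. s \<in> \<Delta> \<Longrightarrow> dist s 0 < d \<Longrightarrow> dist (T s x) (T 0 x) < r - dist v x"
      using strongly_continuous[of x] index_set_zero[OF index_set] unfolding continuous_on_iff by metis
    obtain n where n: "1 / Suc n < d"
      using d nat_approx_posE by blast
    have "dist v (T s x) \<le> r" if "s \<in> \<Delta>" "cmod s \<le> 1 / Suc n" for s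
      using d(2)[of s] that n T_zero dist_triangle[of v "T s x" x] by (simp add: dist_commute)
    then show "x \<in> (\<Union>n. C n)"
      by (auto simp: C_def)
  qed
  then have "ball v r \<subseteq> interior (\<Union>n. C n)"
    by (simp add: interior_maximal)
  then have "interior (\<Union>(range C)) \<noteq> {}"
    using r(1) centre_in_ball[of v r] by blast
  then obtain n where n: "interior (C n) \<noteq> {}"
    using Baire_category_alt[of "euclidean :: 'e topology" "range C"] \<open>\<And>n. closed (C n)\<close>
    by (auto simp: completely_metrizable_space_euclidean interior_of_def interior_def)
  have "T s x \<in> V" if "s \<in> \<Delta>" "x \<in> interior (C n)" "cmod s \<le> 1 / Suc n" for s x
  proof -
    have "x \<in> C n"
      using that interior_subset by blast
    then have "T s x \<in> cball v r"
      using that unfolding C_def by blast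
    then show ?thesis
      using r by blast
  qed
  then show ?thesis
    using n by (intro exI[of _ "interior (C n)"] exI[of _ "1 / Suc n"]) auto
qed

text \<open>
  If \<open>p n = p k\<close>, then the term \<open>u k (S (p n) y)\<close>, small by the first condition, is also close to \<open>y\<close>.
\<close>

lemma (in frechet_space) exists_injectivity_gap:
  fixes u S :: "nat \<Rightarrow> 'e \<Rightarrow> 'e" and p :: "nat \<Rightarrow> nat"
  assumes bwd: "uncond_convergent_uniformly {1..}
      (\<lambda>n k. if n \<le> k then u k (S (p (k - n)) y) else 0)"
    and lim: "(\<lambda>n. u n (S (p n) y)) \<longlonglongrightarrow> y"
    and "y \<noteq> 0"
  shows "\<exists>N. \<forall>n k. n < k \<and> N \<le> n \<and> N \<le> k - n \<longrightarrow> p n \<noteq> p k"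
proof -
  define \<epsilon> where "\<epsilon> = dist y 0 / 2"
  have "0 < \<epsilon>"
    using assms by (simp add: \<epsilon>_def)
  obtain N1 where N1: "\<forall>F. finite F \<and> F \<subseteq> {N1..} \<longrightarrow> (\<forall>k\<in>{1..}.
      dist (\<Sum>n\<in>F. if n \<le> k then u k (S (p (k - n)) y) else 0) 0 < \<epsilon>)"
    using bwd[unfolded uncond_convergent_uniformly_def, rule_format, OF \<open>0 < \<epsilon>\<close>] by (elim exE conjE)
  obtain N2 where N2: "\<And>n. N2 \<le> n \<Longrightarrow> dist (u n (S (p n) y)) y < \<epsilon>"
    using lim \<open>0 < \<epsilon>\<close> unfolding lim_sequentially by metis
  have "p n \<noteq> p k" if nk: "n < k" "max N1 N2 \<le> n" "max N1 N2 \<le> k - n" for n k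
  proof
    assume eq: "p n = p k"
    have "dist (\<Sum>n\<in>{k - n}. if n \<le> k then u k (S (p (k - n)) y) else 0) 0 < \<epsilon>"
      using nk N1[rule_format, of "{k - n}" k] by simp
    then have "dist (u k (S (p k) y)) 0 < \<epsilon>"
      using nk eq by simp
    moreover have "dist (u k (S (p k) y)) y < \<epsilon>"
      using N2 nk by simp
    ultimately show False
      using dist_triangle3[of y 0 "u k (S (p k) y)"] by (simp add: \<epsilon>_def)
  qed
  then show ?thesis
    by blast
qed

text \<open>A value taken infinitely often would be taken at two indices beyond \<open>N\<close>
  with distance at least \<open>N\<close>.\<close>

lemma finite_vimage_of_gap:
  fixes p :: "nat \<Rightarrow> 'a"
  assumes gap: "\<And>n k. n < k \<Longrightarrow> N \<le> n \<Longrightarrow> N \<le> k - n \<Longrightarrow> p n \<noteq> p k"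
    and "finite X"
  shows "finite (p -` X)"
proof -
  have "finite (p -` {j})" for j
  proof (rule ccontr)
    assume inf: "infinite (p -` {j})"
    obtain n where n: "n \<ge> N" "p n = j"
      using inf unfolding infinite_nat_iff_unbounded_le by auto
    obtain k where "k \<ge> n + N + 1" "p k = j"
      using inf unfolding infinite_nat_iff_unbounded_le by auto
    then have "n < k" "N \<le> k - n"
      by simp_all
    then show False
      using gap[of n k] n \<open>p k = j\<close> by simp
  qed
  moreover have "p -` X = (\<Union>j\<in>X. p -` {j})"
    by auto
  ultimately show ?thesis
    using \<open>finite X\<close> by auto
qed

text \<open>The positions are coloured by \<open>cl\<close>, and the target at \<open>n\<close> may
  depend on its colour. The blocks are the colour classes of the sets \<open>A l\<close>; a single
  class may be sparse, so positive density is claimed only for the whole \<open>A l\<close>.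
  Elements of \<open>A l\<close> are at least \<open>N\<close> apart, so \<open>gap\<close> makes
  \<open>p\<close> injective there.\<close>

theorem (in frechet_space) exists_orbit_near_targets:
  fixes u S :: "nat \<Rightarrow> 'e \<Rightarrow> 'e" and p cl :: "nat \<Rightarrow> nat" and Y :: "nat \<Rightarrow> nat \<Rightarrow> 'e"
    and \<epsilon> :: "nat \<Rightarrow> nat \<Rightarrow> real"
  assumes add: "\<And>k a b. u k (a + b) = u k a + u k b"
    and cont: "\<And>k. continuous_on UNIV (u k)"
    and bwd: "\<And>y. y \<in> E0 \<Longrightarrow> uncond_convergent_uniformly {1..}
      (\<lambda>n k. if n \<le> k then u k (S (p (k - n)) y) else 0)"
    and fwd: "\<And>y. y \<in> E0 \<Longrightarrow> uncond_convergent_uniformly {1..} (\<lambda>n k. u k (S (p (k + n)) y))"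
    and ser: "\<And>y. y \<in> E0 \<Longrightarrow> uncond_convergent (\<lambda>n. S (p n) y)"
    and lim: "\<And>y. y \<in> E0 \<Longrightarrow> (\<lambda>n. u n (S (p n) y)) \<longlonglongrightarrow> y"
    and gap: "\<And>n k. n < k \<Longrightarrow> N \<le> n \<Longrightarrow> N \<le> k - n \<Longrightarrow> p n \<noteq> p k"
    and Y: "\<And>l c. c < q \<Longrightarrow> Y l c \<in> E0" and \<epsilon>: "\<And>l c. c < q \<Longrightarrow> 0 < \<epsilon> l c"
    and cl: "\<And>n. cl n < q"
  shows "\<exists>A x. (\<forall>l. \<exists>C>0. \<forall>n. n div C \<le> card (A l \<inter> {1..n})) \<and>
    (\<forall>l. \<forall>n\<in>A l. N \<le> n \<and> dist (u n x) (Y l (cl n)) < \<epsilon> l (cl n)) \<and> (\<forall>l. inj_on p (A l))"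
proof -
  have "0 < q"
    using cl[of 0] by simp
  \<comment> \<open>\<open>c mod q\<close> only supplies a legal target for the unused codes with \<open>q \<le> c\<close>.\<close>
  define y where "y j = (case prod_decode j of (l, c) \<Rightarrow> Y l (c mod q))" for j
  define e where "e j = (case prod_decode j of (l, c) \<Rightarrow> \<epsilon> l (c mod q))" for j
  have y: "y j \<in> E0" and e: "0 < e j" for j
    using Y \<epsilon> \<open>0 < q\<close> by (auto simp: y_def e_def split: prod.split)
  from separated_blocks_vector[of u e "\<lambda>n. S (p n)" y, OF add cont e bwd[OF y] fwd[OF y] ser[OF y] lim[OF y]]
  obtain M :: "nat \<Rightarrow> nat" where M: "\<forall>B. (\<forall>j. \<forall>n\<in>B j. M j \<le> n) \<and>
      (\<forall>i j. \<forall>n\<in>B i. \<forall>k\<in>B j. n < k \<longrightarrow> M i \<le> k - n \<and> M j \<le> k - n) \<and>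
      (\<forall>i j. i \<noteq> j \<longrightarrow> B i \<inter> B j = {}) \<longrightarrow> (\<exists>x. \<forall>j. \<forall>n\<in>B j. dist (u n x) (y j) < e j)"
    by (elim exE)
  \<comment> \<open>One gap for all \<open>q\<close> colours of the target \<open>l\<close>, and
    large enough for \<open>gap\<close>.\<close>
  define L where "L l = N + (\<Sum>c<q. M (prod_encode (l, c)))" for l
  have L: "N \<le> L l" "c < q \<Longrightarrow> M (prod_encode (l, c)) \<le> L l" for l c
    using member_le_sum[of c "{..<q}" "\<lambda>c. M (prod_encode (l, c))"] by (auto simp: L_def)
  from separated_sets_positive_density[of L]
  obtain A :: "nat \<Rightarrow> nat set" where A: "\<forall>l. \<forall>n\<in>A l. L l \<le> n"
    "\<forall>i j. \<forall>n\<in>A i. \<forall>k\<in>A j. n < k \<longrightarrow> L i + L j \<le> k - n"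
    "\<forall>i j. i \<noteq> j \<longrightarrow> A i \<inter> A j = {}"
    and A_dens: "\<forall>l. \<exists>C>0. \<forall>n. n div C \<le> card (A l \<inter> {1..n})"
    by (elim exE conjE)
  note A_ge = A(1)[rule_format] and A_sep = A(2)[rule_format] and A_disj = A(3)[rule_format]
  define B where "B j = (case prod_decode j of (l, c) \<Rightarrow> {n \<in> A l. cl n = c})" for j
  have B: "n \<in> A (fst (prod_decode j)) \<and> cl n = snd (prod_decode j)" if "n \<in> B j" for n j
    using that by (auto simp: B_def split: prod.splits)
  have M_le: "M j \<le> L (fst (prod_decode j))" if "n \<in> B j" for n j
    using B[OF that] cl[of n] L(2)[of "snd (prod_decode j)" "fst (prod_decode j)"] by simp
  have "\<exists>x. \<forall>j. \<forall>n\<in>B j. dist (u n x) (y j) < e j"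
  proof (rule M[THEN spec, THEN mp]; intro conjI; intro allI ballI impI)
    fix j n assume n: "n \<in> B j"
    then show "M j \<le> n"
      using M_le[OF n] A_ge B[OF n] by (meson order_trans)
  next
    fix i j n k assume *: "n \<in> B i" "k \<in> B j" "n < k"
    then have "L (fst (prod_decode i)) + L (fst (prod_decode j)) \<le> k - n"
      using A_sep B by blast
    then show "M i \<le> k - n \<and> M j \<le> k - n"
      using M_le[OF *(1)] M_le[OF *(2)] by simp
  next
    fix i j :: nat assume "i \<noteq> j"
    show "B i \<inter> B j = {}"
    proof (rule ccontr)
      assume "B i \<inter> B j \<noteq> {}"
      then obtain n where n: "n \<in> B i" "n \<in> B j"
        by blast
      then have "fst (prod_decode i) = fst (prod_decode j)"
        using A_disj B by blast
      moreover have "snd (prod_decode i) = snd (prod_decode j)"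
        using n B by metis
      ultimately have "prod_decode i = prod_decode j"
        by (rule prod_eqI)
      then show False
        using \<open>i \<noteq> j\<close> by simp
    qed
  qed
  then obtain x where x: "\<And>j n. n \<in> B j \<Longrightarrow> dist (u n x) (y j) < e j"
    by blast
  have "dist (u n x) (Y l (cl n)) < \<epsilon> l (cl n)" if "n \<in> A l" for n l
    using that x[of n "prod_encode (l, cl n)"] cl[of n] by (simp add: B_def y_def e_def)
  moreover have "N \<le> n" if "n \<in> A l" for n l
    using A_ge[OF that] L(1)[of l] by simp
  moreover have "inj_on p (A l)" for l
  proof (rule linorder_inj_onI')
    fix n k assume *: "n \<in> A l" "k \<in> A l" "n < k"
    show "p n \<noteq> p k"
      using A_sep[OF *] A_ge[OF *(1)] L(1)[of l] by (intro gap[OF *(3)]) auto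
  qed
  ultimately show ?thesis
    using A_dens by (intro exI[of _ A] exI[of _ x]) blast
qed

text \<open>Rounding by \<open>div C\<close> loses less than \<open>C\<close>, hence less than half
  of \<open>n\<close> once \<open>n \<ge> 2 * C\<close>; so \<open>1 / (2 * C)\<close> bounds the
  density.\<close>

lemma lower_density_seq_pos:
  assumes "0 < C" "\<And>n. n div C \<le> card {j \<in> A. 1 \<le> j \<and> real j \<le> m n}"
  shows "0 < lower_density_seq m A"
proof -
  have "ereal (1 / (2 * C)) \<le> lower_density_seq m A"
    unfolding lower_density_seq_def
  proof (rule Liminf_bounded, rule eventually_sequentiallyI[of "2 * C"])
    fix n assume n: "2 * C \<le> n"
    have "n < C * (n div C) + C"
      using assms(1) by (metis add.commute add_less_cancel_left mod_less_divisor mult_div_mod_eq)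
    then have "n \<le> 2 * C * (n div C)"
      using n by (simp add: algebra_simps)
    also have "\<dots> \<le> 2 * C * card {j \<in> A. 1 \<le> j \<and> real j \<le> m n}"
      using assms(2) by simp
    finally have "real n \<le> real (2 * C * card {j \<in> A. 1 \<le> j \<and> real j \<le> m n})"
      by (rule of_nat_mono)
    then show "ereal (1 / (2 * C)) \<le> ereal (card {j \<in> A. 1 \<le> j \<and> real j \<le> m n} / n)"
      using n assms(1) by (simp add: field_simps)
  qed
  moreover have "0 < ereal (1 / (2 * C))"
    using assms(1) by simp
  ultimately show ?thesis
    by order
qed

text \<open>The floor costs at most one and \<open>div C\<close> less than \<open>C\<close>; for
  \<open>r \<ge> 2 * C + 2\<close> the total loss is at most \<open>r / 2\<close>.\<close>

lemma lower_density_index_pos: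
  assumes "0 < C" "0 < c"
    and "\<And>r. 0 \<le> r \<Longrightarrow> real (nat \<lfloor>r\<rfloor> div C) * c \<le> index_measure \<Delta> (A \<inter> initial_part \<Delta> (h r))"
  shows "0 < lower_density_index \<Delta> h A"
proof -
  have "ereal (c / (2 * C)) \<le> lower_density_index \<Delta> h A"
    unfolding lower_density_index_def
  proof (rule Liminf_bounded, rule eventually_at_top_linorderI[of "2 * real C + 2"])
    fix r assume r: "2 * real C + 2 \<le> r"
    define n where "n = nat \<lfloor>r\<rfloor>"
    have "r - 1 \<le> real n"
      using r by (simp add: n_def)
    have "n < C * (n div C) + C"
      using assms(1) by (metis add.commute add_less_cancel_left mod_less_divisor mult_div_mod_eq)
    then have "real n < real C * real (n div C) + real C"
      by (metis of_nat_add of_nat_less_iff of_nat_mult)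
    then have "r \<le> 2 * real C * real (n div C)"
      using \<open>r - 1 \<le> real n\<close> r by simp
    then have "r * c \<le> 2 * real C * (real (n div C) * c)"
      using assms(2) by (metis less_imp_le mult.assoc mult_right_mono)
    also have "\<dots> \<le> 2 * real C * index_measure \<Delta> (A \<inter> initial_part \<Delta> (h r))"
      using assms(3)[of r] r unfolding n_def by (intro mult_left_mono) auto
    finally show "ereal (c / (2 * C)) \<le> ereal (index_measure \<Delta> (A \<inter> initial_part \<Delta> (h r)) / r)"
      using r assms(1) by (simp add: field_simps)
  qed
  moreover have "0 < ereal (c / (2 * C))"
    using assms(1,2) by simp
  ultimately show ?thesis
    by order
qed

text \<open>Bounded uniformly discrete sets are finite, and \<open>t\<close> is injective on
  \<open>I\<close>. This leaves only finitely many \<open>t n\<close> near the origin.\<close>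

lemma finite_separated_bounded:
  fixes t :: "'i \<Rightarrow> 'a::heine_borel"
  assumes "0 < \<delta>" "\<And>i j. i \<in> I \<Longrightarrow> j \<in> I \<Longrightarrow> i \<noteq> j \<Longrightarrow> \<delta> \<le> dist (t i) (t j)" "bounded (t ` I)"
  shows "finite I"
proof -
  have "inj_on t I"
    using assms(1,2) by (intro inj_onI) (metis dist_self not_le)
  have "uniform_discrete (t ` I)"
    unfolding uniform_discrete_def using assms(1,2)
    by (intro exI[of _ \<delta>]) (metis (no_types, lifting) imageE not_le)
  then have "finite (t ` I)"
    using assms(3) uniform_discrete_finite_iff by blast
  then show ?thesis
    using \<open>inj_on t I\<close> finite_imageD by blast
qed

section \<open>Frequent hypercyclicity of sequences and semigroups\<close>

lemma (in C0_semigroup) T_plus: "a \<in> \<Delta> \<Longrightarrow> b \<in> \<Delta> \<Longrightarrow> T (a + b) x = T a (T b x)"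
  using T_add by simp

lemma (in C0_semigroup) T_additive: "a \<in> \<Delta> \<Longrightarrow> T a (x + y) = T a x + T a y"
  using linear_T by (simp add: Vector_Spaces.linear_iff)

lemma (in C0_semigroup) dense_range_sum:
  assumes "finite G" "G \<subseteq> \<Delta>" "\<And>s. s \<in> G \<Longrightarrow> closure (range (T s)) = UNIV"
  shows "closure (range (T (\<Sum>G))) = UNIV"
  using assms
proof (induction G)
  case empty
  then show ?case
    by (simp add: T_zero)
next
  case (insert s G)
  have "\<Sum>G \<in> \<Delta>"
    using insert.prems by (intro index_set_sum[OF index_set]) auto
  then have "T (\<Sum>(insert s G)) = T s \<circ> T (\<Sum>G)"
    using insert T_add by simp
  moreover have "closure (range (T s \<circ> T (\<Sum>G))) = UNIV"
    using insert continuous_T by (intro closure_range_comp) auto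
  ultimately show ?case
    by (simp only:)
qed

theorem theorem2p10:
  fixes sc :: "'k::real_normed_field \<Rightarrow> 'e::{topological_ab_group_add,complete_space} \<Rightarrow> 'e"
    and \<Delta> :: "complex set"
    and T :: "complex \<Rightarrow> 'e \<Rightarrow> 'e"
    and \<delta> :: real
    and f g :: "real \<Rightarrow> real"
    and m :: "nat \<Rightarrow> real"
    and t :: "nat \<Rightarrow> complex"
    and E0 :: "'e set"
    and S :: "nat \<Rightarrow> 'e \<Rightarrow> 'e"
  assumes "frechet_space sc"
    and "separable TYPE('e)"
    and "infinite_dimensional sc"
    and "C0_semigroup sc \<Delta> T"
    and "\<delta> > 0"
    and "\<forall>r\<ge>0. f r \<ge> 1" and "mono_on {0..} f"
    and "\<forall>k. m k = f (real k)"
    and "\<forall>n\<ge>1. t n \<in> \<Delta> - {0}"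
    and "closure E0 = UNIV"
    and i: "\<forall>y\<in>E0. uncond_convergent_uniformly {1..}
      (\<lambda>n k. if n \<le> k then T (t (nat \<lfloor>m k\<rfloor>)) (S (nat \<lfloor>m (k - n)\<rfloor>) y) else 0)"
    and ii: "\<forall>y\<in>E0. uncond_convergent_uniformly {1..}
      (\<lambda>n k. T (t (nat \<lfloor>m k\<rfloor>)) (S (nat \<lfloor>m (k + n)\<rfloor>) y))"
    and iii: "\<forall>y\<in>E0. uncond_convergent (\<lambda>n. S (nat \<lfloor>m n\<rfloor>) y)"
    and iv: "\<forall>y\<in>E0. (\<lambda>n. T (t (nat \<lfloor>m n\<rfloor>)) (S (nat \<lfloor>m n\<rfloor>) y)) \<longlonglongrightarrow> y"
    and v: "\<forall>n\<ge>1. \<forall>l\<ge>1. l \<noteq> n \<longrightarrow> cmod (t n - t l) \<ge> \<delta>"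
      "\<forall>r\<ge>1. g r \<ge> 1" "mono_on {1..} g" "\<forall>n\<ge>1. cmod (t n) \<le> g (real n)"
  shows "l_frequently_hypercyclic m (\<lambda>n. T (t n)) \<and>
    semigroup_frequently_hypercyclic \<Delta> (g \<circ> f) T"
proof -
  interpret C0_semigroup sc \<Delta> T
    by fact

  \<comment> \<open>Reformulation of the hypotheses in terms of \<open>u\<close> and
    \<open>p\<close>\<close>
  define p where "p k = nat \<lfloor>m k\<rfloor>" for k
  define u where "u k = T (t (p k))" for k
  have m_ge: "1 \<le> m k" for k
    using assms(6,8) by simp
  \<comment> \<open>The bound \<open>f \<ge> 1\<close> keeps \<open>p k\<close>, even for
    \<open>k = 0\<close>, among the indices \<open>n \<ge> 1\<close> on which \<open>t\<close> is
    controlled.\<close>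
  have p_ge: "1 \<le> p k" and p_le: "real (p k) \<le> m k" for k
    using m_ge[of k] by (simp_all add: p_def le_nat_floor)
  have m_mono: "m k \<le> m n" if "k \<le> n" for k n
    using that assms(7,8) by (simp add: mono_on_def)
  have t_mem: "t (p k) \<in> \<Delta>" for k
    using assms(9) p_ge by blast
  have u_add: "u k (a + b) = u k a + u k b" for k a b
    unfolding u_def by (rule T_additive[OF t_mem])
  have u_cont: "continuous_on UNIV (u k)" for k
    unfolding u_def by (rule continuous_T[OF t_mem])
  have bwd: "uncond_convergent_uniformly {1..}
      (\<lambda>n k. if n \<le> k then u k (S (p (k - n)) y) else 0)" if "y \<in> E0" for y
    unfolding u_def p_def using i that by blast
  have fwd: "uncond_convergent_uniformly {1..} (\<lambda>n k. u k (S (p (k + n)) y))" if "y \<in> E0" for y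
    unfolding u_def p_def using ii that by blast
  have ser: "uncond_convergent (\<lambda>n. S (p n) y)" if "y \<in> E0" for y
    unfolding p_def using iii that by blast
  have lim: "(\<lambda>n. u n (S (p n) y)) \<longlonglongrightarrow> y" if "y \<in> E0" for y
    unfolding u_def p_def using iv that by blast

  \<comment> \<open>Repetitions of \<open>p\<close>, and a countable family of targets\<close>
  have "\<exists>y\<in>E0. y \<noteq> 0"
  proof (rule ccontr)
    assume "\<not> (\<exists>y\<in>E0. y \<noteq> 0)"
    then have "E0 \<subseteq> {0}"
      by blast
    then have "UNIV \<subseteq> {0::'e}"
      using closure_minimal[of E0 "{0}"] assms(10) by simp
    then have "span {} = UNIV"
      by (auto simp: span_empty)
    then show False
      using assms(3) unfolding infinite_dimensional_def by blast
  qed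
  then obtain y0 where "y0 \<in> E0" "y0 \<noteq> 0"
    by blast
  then obtain N0 where "\<forall>n k. n < k \<and> N0 \<le> n \<and> N0 \<le> k - n \<longrightarrow> p n \<noteq> p k"
    using exists_injectivity_gap[of u S p y0, OF bwd lim] by blast
  then have gap: "p n \<noteq> p k" if "n < k" "N0 \<le> n" "N0 \<le> k - n" for n k
    using that by blast
  obtain V :: "nat \<Rightarrow> 'e set" where V: "\<forall>l. open (V l) \<and> V l \<noteq> {}"
    and V_base: "\<forall>W. open W \<and> W \<noteq> {} \<longrightarrow> (\<exists>l. V l \<subseteq> W)"
    using separable_countable_base[OF assms(2)] by (elim exE conjE)
  have dense_ball: "\<exists>y e. y \<in> E0 \<and> 0 < e \<and> ball y e \<subseteq> W" if W: "open W" "W \<noteq> {}" for W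
  proof -
    obtain y where "y \<in> W" "y \<in> E0"
      using W assms(10) open_Int_closure_eq_empty[of W E0] by auto
    then show ?thesis
      using W openE by metis
  qed

  \<comment> \<open>The sequence of operators\<close>
  have "l_frequently_hypercyclic m (\<lambda>n. T (t n))"
  proof -
    have "\<forall>l. \<exists>y e. y \<in> E0 \<and> 0 < e \<and> ball y e \<subseteq> V l"
      by (intro allI dense_ball) (use V in auto)
    then obtain y e where y: "\<And>l. y l \<in> E0" "\<And>l. 0 < e l" "\<And>l. ball (y l) (e l) \<subseteq> V l"
      by metis
    \<comment> \<open>Here the targets do not vary with the position, so a single colour is
      used.\<close>
    have "\<exists>A x. (\<forall>l. \<exists>C>0. \<forall>n. n div C \<le> card (A l \<inter> {1..n})) \<and>
        (\<forall>l. \<forall>n\<in>A l. N0 \<le> n \<and> dist (u n x) (y l) < e l) \<and> (\<forall>l. inj_on p (A l))"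
      by (rule exists_orbit_near_targets[of u E0 S p N0 1 "\<lambda>l _. y l" "\<lambda>l _. e l" "\<lambda>_. 0",
            OF u_add u_cont bwd fwd ser lim gap y(1) y(2)]) simp_all
    then obtain A x where A: "\<forall>l. \<exists>C>0. \<forall>n. n div C \<le> card (A l \<inter> {1..n})"
      and x: "\<forall>l. \<forall>n\<in>A l. N0 \<le> n \<and> dist (u n x) (y l) < e l" and inj: "\<forall>l. inj_on p (A l)"
      by (elim exE conjE)
    have "0 < lower_density_seq m {n. 1 \<le> n \<and> T (t n) x \<in> W}" if W: "open W" "W \<noteq> {}" for W
    proof -
      obtain l where l: "V l \<subseteq> W"
        using V_base W by blast
      obtain C where C: "0 < C" "\<And>n. n div C \<le> card (A l \<inter> {1..n})"
        using A by blast
      show ?thesis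
      proof (rule lower_density_seq_pos[OF C(1)])
        fix n
        let ?H = "{j \<in> {n. 1 \<le> n \<and> T (t n) x \<in> W}. 1 \<le> j \<and> real j \<le> m n}"
        have "p ` (A l \<inter> {1..n}) \<subseteq> ?H"
        proof
          fix j assume "j \<in> p ` (A l \<inter> {1..n})"
          then obtain k where k: "k \<in> A l" "k \<le> n" "j = p k"
            by auto
          have "u k x \<in> ball (y l) (e l)"
            using x k by (simp add: dist_commute)
          then have "T (t j) x \<in> W"
            using y(3) l k(3) unfolding u_def by blast
          moreover have "real j \<le> m n"
            using p_le[of k] m_mono[OF k(2)] k(3) by simp
          ultimately show "j \<in> ?H"
            using p_ge k(3) by simp
        qed
        moreover have "finite ?H"
          by (rule finite_subset[of _ "{..nat \<lfloor>m n\<rfloor>}"]) (auto simp: le_nat_floor)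
        ultimately have "card (p ` (A l \<inter> {1..n})) \<le> card ?H"
          by (rule card_mono[rotated])
        moreover have "card (p ` (A l \<inter> {1..n})) = card (A l \<inter> {1..n})"
          using inj by (intro card_image) (meson inf_le1 inj_on_subset)
        ultimately show "n div C \<le> card ?H"
          using C(2)[of n] by linarith
      qed
    qed
    then show ?thesis
      unfolding l_frequently_hypercyclic_def by blast
  qed

  \<comment> \<open>The semigroup: shifts, adjusted targets and counting of discs\<close>
  moreover have "semigroup_frequently_hypercyclic \<Delta> (g \<circ> f) T"
  proof -
    \<comment> \<open>Two points at distance \<open>\<delta>\<close>, each moved by at most
      \<open>\<sigma>\<close>, remain at distance
      \<open>\<delta> - 2 * \<sigma> = 2 * \<sigma>\<close>.\<close>
    define \<sigma> where "\<sigma> = \<delta> / 4"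
    have "0 < \<sigma>"
      using assms(5) by (simp add: \<sigma>_def)
    obtain G where G: "finite G" "G \<subseteq> \<Delta>" "\<forall>s\<in>G. cmod s \<le> \<sigma>"
      and retreat: "\<forall>\<tau>\<in>\<Delta>. 2 * \<sigma> \<le> cmod \<tau> \<longrightarrow>
        (\<exists>s\<in>G. \<tau> - s \<in> \<Delta> \<and> cmod (\<tau> - s) \<le> cmod \<tau> - \<sigma> / 4)"
      using index_set_retreat[OF index_set \<open>0 < \<sigma>\<close>] by blast
    \<comment> \<open>The retreat needs \<open>cmod (t (p k)) \<ge> 2 * \<sigma>\<close>. Finitely
      many \<open>t n\<close> violate this, and \<open>p\<close> takes each value only finitely
      often, so every large \<open>k\<close> qualifies.\<close>
    have "finite {n. 1 \<le> n \<and> cmod (t n) < 2 * \<sigma>}"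
    proof (rule finite_separated_bounded[of \<delta> _ t])
      show "bounded (t ` {n. 1 \<le> n \<and> cmod (t n) < 2 * \<sigma>})"
        by (rule bounded_subset[OF bounded_ball[of 0 "2 * \<sigma>"]]) auto
    qed (use assms(5) v(1) in \<open>auto simp: dist_norm\<close>)
    then have "finite (p -` {n. 1 \<le> n \<and> cmod (t n) < 2 * \<sigma>})"
      using finite_vimage_of_gap[of N0 p] gap by blast
    then obtain K1 where "\<forall>k\<in>p -` {n. 1 \<le> n \<and> cmod (t n) < 2 * \<sigma>}. k < K1"
      using finite_nat_set_iff_bounded by blast
    then have far: "2 * \<sigma> \<le> cmod (t (p k))" if "K1 \<le> k" for k
      using that p_ge[of k] by (force simp: not_le[symmetric])
    then have "\<forall>k. \<exists>s. K1 \<le> k \<longrightarrow> s \<in> G \<and> t (p k) - s \<in> \<Delta> \<and> cmod (t (p k) - s) \<le> cmod (t (p k)) - \<sigma> / 4"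
      using retreat t_mem by meson
    then obtain c where c: "\<And>k. K1 \<le> k \<Longrightarrow> c k \<in> G" "\<And>k. K1 \<le> k \<Longrightarrow> t (p k) - c k \<in> \<Delta>"
      "\<And>k. K1 \<le> k \<Longrightarrow> cmod (t (p k) - c k) \<le> cmod (t (p k)) - \<sigma> / 4"
      by metis
    \<comment> \<open>Shifts used infinitely often: for these \<open>u k (S (p k) y) \<longlonglongrightarrow> y\<close> runs through the range of \<open>T s\<close>.\<close>
    define G' where "G' = {s \<in> G. infinite {k. K1 \<le> k \<and> c k = s}}"
    have "G' \<subseteq> \<Delta>" "finite G'"
      using G by (auto simp: G'_def)
    have "finite (\<Union>s\<in>G - G'. {k. K1 \<le> k \<and> c k = s})"
      using G by (auto simp: G'_def)
    then obtain K2 where K2: "\<forall>k\<in>(\<Union>s\<in>G - G'. {k. K1 \<le> k \<and> c k = s}). k < K2"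
      using finite_nat_set_iff_bounded by blast
    have c_G': "c k \<in> G'" if "max K1 K2 \<le> k" for k
    proof (rule ccontr)
      assume "c k \<notin> G'"
      then have "k < K2"
        using that c(1)[of k] K2 by auto
      then show False
        using that by simp
    qed
    have dense: "closure (range (T s)) = UNIV" if "s \<in> G'" for s
    proof -
      have "y \<in> closure (range (T s))" if "y \<in> E0" for y
        unfolding closure_approachable
      proof (intro allI impI)
        fix e :: real assume "0 < e"
        then obtain n where n: "\<And>k. n \<le> k \<Longrightarrow> dist (u k (S (p k) y)) y < e"
          using lim[OF \<open>y \<in> E0\<close>] unfolding lim_sequentially by blast
        have "infinite {k. K1 \<le> k \<and> c k = s}"
          using \<open>s \<in> G'\<close> by (simp add: G'_def)
        then obtain k where k: "n \<le> k" "K1 \<le> k" "c k = s"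
          unfolding infinite_nat_iff_unbounded_le by blast
        have "u k (S (p k) y) = T (s + (t (p k) - s)) (S (p k) y)"
          by (simp add: u_def)
        also have "\<dots> = T s (T (t (p k) - s) (S (p k) y))"
          using k c(1,2)[of k] G(2) by (intro T_plus) auto
        finally show "\<exists>z\<in>range (T s). dist z y < e"
          using n[OF k(1)] by auto
      qed
      then have "closure E0 \<subseteq> closure (range (T s))"
        by (intro closure_minimal) auto
      then show ?thesis
        using assms(10) by auto
    qed
    \<comment> \<open>Every recurrent shift occurs once in \<open>w\<close>. Hence
      \<open>w - s\<close> is a sum of the others and lies in \<open>\<Delta>\<close>, although
      \<open>\<Delta>\<close> need not be closed under differences, and \<open>T (w - s)\<close> has
      dense range.\<close>
    define w where "w = \<Sum>G'"
    have w: "w \<in> \<Delta>"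
      unfolding w_def using \<open>G' \<subseteq> \<Delta>\<close> by (intro index_set_sum[OF index_set]) auto
    have w_diff: "w - s = \<Sum>(G' - {s})" if "s \<in> G'" for s
      using that \<open>finite G'\<close> by (simp add: w_def sum_diff1)
    have w_mem: "w - s \<in> \<Delta>" if "s \<in> G'" for s
      unfolding w_diff[OF that] using \<open>G' \<subseteq> \<Delta>\<close> by (intro index_set_sum[OF index_set]) auto
    have w_dense: "closure (range (T (w - s))) = UNIV" if "s \<in> G'" for s
      unfolding w_diff[OF that] using \<open>G' \<subseteq> \<Delta>\<close> \<open>finite G'\<close> dense by (intro dense_range_sum) auto

    obtain gs where gs: "set gs = G'"
      using finite_list[OF \<open>finite G'\<close>] by blast
    have "G' \<noteq> {}"
      using c_G' by blast
    then have "0 < length gs"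
      using gs by auto
    \<comment> \<open>The shifts become colours through their positions in \<open>gs\<close>; below
      \<open>max K1 K2\<close> the colour is arbitrary.\<close>
    have "\<exists>i<length gs. max K1 K2 \<le> k \<longrightarrow> gs ! i = c k" for k
      using c_G'[of k] gs \<open>0 < length gs\<close> by (metis in_set_conv_nth)
    then obtain cl where cl: "\<And>k. cl k < length gs" "\<And>k. max K1 K2 \<le> k \<Longrightarrow> gs ! cl k = c k"
      by metis
    have "\<forall>l. \<exists>U \<eta>. open U \<and> U \<noteq> {} \<and> 0 < \<eta> \<and> (\<forall>s\<in>\<Delta>. \<forall>x\<in>U. cmod s \<le> \<eta> \<longrightarrow> T s x \<in> V l)"
      by (intro allI exists_uniform_neighbourhood) (use V in auto)
    then obtain U \<eta> where U: "\<And>l. open (U l)" "\<And>l. U l \<noteq> {}" "\<And>l. 0 < \<eta> l"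
      "\<And>l s x. s \<in> \<Delta> \<Longrightarrow> x \<in> U l \<Longrightarrow> cmod s \<le> \<eta> l \<Longrightarrow> T s x \<in> V l"
      by metis
    \<comment> \<open>The target for colour \<open>i\<close> is the preimage of \<open>U l\<close>
      under \<open>T (w - gs ! i)\<close>; it is open by continuity and nonempty by density of the
      range.\<close>
    have ex: "\<exists>y e. i < length gs \<longrightarrow> y \<in> E0 \<and> 0 < e \<and> ball y e \<subseteq> T (w - gs ! i) -` U l" for l i
    proof (cases "i < length gs")
      case True
      then have s: "gs ! i \<in> G'"
        using gs by auto
      have "open (T (w - gs ! i) -` U l)"
        using U(1) continuous_T[OF w_mem[OF s]] by (simp add: open_vimage)
      moreover have "T (w - gs ! i) -` U l \<noteq> {}"
        using U(1,2) w_dense[OF s] open_Int_closure_eq_empty[of "U l" "range (T (w - gs ! i))"] by auto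
      ultimately show ?thesis
        using dense_ball by blast
    qed blast
    have "\<forall>l i. \<exists>y e. i < length gs \<longrightarrow> y \<in> E0 \<and> 0 < e \<and> ball y e \<subseteq> T (w - gs ! i) -` U l"
      by (intro allI ex)
    then obtain Y e where Y: "\<And>l i. i < length gs \<Longrightarrow> Y l i \<in> E0" "\<And>l i. i < length gs \<Longrightarrow> 0 < e l i"
      "\<And>l i. i < length gs \<Longrightarrow> ball (Y l i) (e l i) \<subseteq> T (w - gs ! i) -` U l"
      by metis
    define N where "N = max N0 (max K1 K2)"
    have gapN: "p n \<noteq> p k" if "n < k" "N \<le> n" "N \<le> k - n" for n k
      using that by (intro gap) (auto simp: N_def)
    have "\<exists>A x. (\<forall>l. \<exists>C>0. \<forall>n. n div C \<le> card (A l \<inter> {1..n})) \<and>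
        (\<forall>l. \<forall>n\<in>A l. N \<le> n \<and> dist (u n x) (Y l (cl n)) < e l (cl n)) \<and> (\<forall>l. inj_on p (A l))"
      by (rule exists_orbit_near_targets[of u E0 S p N "length gs" Y e cl,
            OF u_add u_cont bwd fwd ser lim gapN Y(1) Y(2) cl(1)])
    then obtain A x where A: "\<forall>l. \<exists>C>0. \<forall>n. n div C \<le> card (A l \<inter> {1..n})"
      and x: "\<forall>l. \<forall>n\<in>A l. N \<le> n \<and> dist (u n x) (Y l (cl n)) < e l (cl n)"
      and inj: "\<forall>l. inj_on p (A l)"
      by (elim exE conjE)
    have near: "T (w - c n) (u n x) \<in> U l" and K: "K1 \<le> n" "c n \<in> G'" if "n \<in> A l" for n l
    proof -
      have n: "max K1 K2 \<le> n" "dist (u n x) (Y l (cl n)) < e l (cl n)"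
        using x that by (auto simp: N_def)
      then show "K1 \<le> n" "c n \<in> G'"
        using c_G' by auto
      show "T (w - c n) (u n x) \<in> U l"
        using Y(3)[OF cl(1), of l n] n cl(2)[OF n(1)] by (auto simp: dist_commute)
    qed
    have "0 < lower_density_index \<Delta> (g \<circ> f) {\<tau> \<in> \<Delta>. T \<tau> (T w x) \<in> W}" if W: "open W" "W \<noteq> {}" for W
    proof -
      obtain l where l: "V l \<subseteq> W"
        using V_base W by blast
      obtain C where C: "0 < C" "\<And>n. n div C \<le> card (A l \<inter> {1..n})"
        using A by blast
      \<comment> \<open>\<open>\<eta> l\<close> keeps \<open>T s\<close> from leaving
        \<open>V l\<close>, and \<open>\<sigma> / 4\<close> is the radius gained by the
        retreat.\<close>
      define \<rho> where "\<rho> = min (\<eta> l) (\<sigma> / 4)"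
      have \<rho>: "0 < \<rho>" "\<rho> \<le> \<eta> l" "\<rho> \<le> \<sigma> / 4"
        using U(3) \<open>0 < \<sigma>\<close> by (auto simp: \<rho>_def)
      \<comment> \<open>Return times form a relatively open subset of \<open>\<Delta>\<close>, as
        the packing estimate requires.\<close>
      obtain O' where O': "open O'" "{\<tau> \<in> \<Delta>. T \<tau> (T w x) \<in> W} = \<Delta> \<inter> O'"
        using continuous_openin_preimage_gen[OF strongly_continuous W(1), of "T w x"]
        unfolding openin_open by (auto simp: Int_def vimage_def)
      define z where "z n = t (p n) - c n" for n
      have z_mem: "z n \<in> \<Delta>" if "n \<in> A l" for n
        using c(2) K that by (simp add: z_def)
      have z_sep: "2 * \<sigma> \<le> dist (z n) (z k)" if nk: "n \<in> A l" "k \<in> A l" "n \<noteq> k" for n k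
      proof -
        have "p n \<noteq> p k"
          using inj nk by (meson inj_onD)
        then have "\<delta> \<le> cmod (t (p n) - t (p k))"
          using v(1) p_ge by metis
        moreover have "cmod (c n) \<le> \<sigma>" "cmod (c k) \<le> \<sigma>"
          using K nk G(3) by (auto simp: G'_def)
        moreover have "t (p n) - t (p k) = (z n - z k) + (c n - c k)"
          by (simp add: z_def)
        ultimately show ?thesis
          using norm_triangle_ineq[of "z n - z k" "c n - c k"] norm_triangle_ineq4[of "c n" "c k"]
          by (simp add: dist_norm \<sigma>_def)
      qed
      show ?thesis
      proof (rule lower_density_index_pos[OF C(1) index_measure_initial_part_pos[OF index_set \<rho>(1)]])
        fix r :: real assume "0 \<le> r"
        define P where "P = z ` (A l \<inter> {1..nat \<lfloor>r\<rfloor>})"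
        have "inj_on z (A l \<inter> {1..nat \<lfloor>r\<rfloor>})"
          using z_sep \<open>0 < \<sigma>\<close> by (intro inj_onI) force
        then have "nat \<lfloor>r\<rfloor> div C \<le> card P"
          unfolding P_def using C(2) by (simp add: card_image)
        then have "real (nat \<lfloor>r\<rfloor> div C) * index_measure \<Delta> (initial_part \<Delta> \<rho>) \<le>
            real (card P) * index_measure \<Delta> (initial_part \<Delta> \<rho>)"
          using index_measure_initial_part_pos[OF index_set \<rho>(1)] by (intro mult_right_mono) auto
        also have "\<dots> \<le> index_measure \<Delta> (\<Delta> \<inter> O' \<inter> initial_part \<Delta> ((g \<circ> f) r))"
        proof (rule index_measure_packing[OF index_set O'(1) \<rho>(1)])
          show "finite P" "P \<subseteq> \<Delta>"
            using z_mem by (auto simp: P_def)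
        next
          fix a b assume "a \<in> P" "b \<in> P" "a \<noteq> b"
          then obtain n k where "n \<in> A l" "k \<in> A l" "n \<noteq> k" "a = z n" "b = z k"
            unfolding P_def by blast
          then show "2 * \<rho> < dist a b"
            using z_sep[of n k] \<rho> \<open>0 < \<sigma>\<close> by simp
        next
          fix a s assume "a \<in> P" and s: "s \<in> \<Delta>" "cmod s \<le> \<rho>"
          then obtain n where n: "n \<in> A l" "n \<le> nat \<lfloor>r\<rfloor>" "a = z n"
            by (auto simp: P_def)
          have mem: "a + s \<in> \<Delta>" "c n \<in> \<Delta>" "w - c n \<in> \<Delta>"
            using index_set_add[OF index_set z_mem s(1)] K n w_mem \<open>G' \<subseteq> \<Delta>\<close> by auto
          have "T (a + s) (T w x) = T (a + s + w) x"
            using T_plus[OF mem(1) w] by simp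
          \<comment> \<open>The shift \<open>c n\<close> cancels against \<open>w\<close>, and the
            sum is regrouped into elements of \<open>\<Delta>\<close> only, so that the semigroup
            law applies.\<close>
          also have "a + s + w = s + ((w - c n) + t (p n))"
            by (simp add: n z_def)
          also have "T \<dots> x = T s (T (w - c n) (u n x))"
            using T_plus[OF s(1) index_set_add[OF index_set mem(3) t_mem]] T_plus[OF mem(3) t_mem]
            by (simp add: u_def)
          also have "\<dots> \<in> W"
            using U(4)[OF s(1) near[OF n(1)]] s(2) \<rho>(2) l by auto
          finally have "a + s \<in> O'"
            using mem(1) O'(2) by blast
          \<comment> \<open>The disc has radius at most \<open>\<sigma> / 4\<close>, just what the
            retreat gained, so it stays within \<open>g (p n)\<close>; monotonicity of
            \<open>f\<close> and \<open>g\<close> gives \<open>g (f r)\<close>.\<close>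
          moreover have "cmod (a + s) \<le> (g \<circ> f) r"
          proof -
            have "real n \<le> r"
              using n(2) \<open>0 \<le> r\<close> by linarith
            then have "m n \<le> f r"
              using assms(7,8) \<open>0 \<le> r\<close> by (simp add: mono_on_def)
            then have "real (p n) \<le> f r"
              using p_le[of n] by simp
            then have "g (real (p n)) \<le> g (f r)"
              using v(3) p_ge[of n] assms(6) \<open>0 \<le> r\<close> by (simp add: mono_on_def)
            moreover have "cmod (t (p n)) \<le> g (real (p n))"
              using v(4) p_ge by blast
            moreover have "cmod a \<le> cmod (t (p n)) - \<sigma> / 4"
              using c(3) K n by (simp add: z_def)
            ultimately show ?thesis
              using norm_triangle_ineq[of a s] s(2) \<rho>(3) by simp
          qed
          ultimately show "a + s \<in> O' \<and> cmod (a + s) \<le> (g \<circ> f) r"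
            by blast
        qed
        finally show "real (nat \<lfloor>r\<rfloor> div C) * index_measure \<Delta> (initial_part \<Delta> \<rho>) \<le>
            index_measure \<Delta> ({\<tau> \<in> \<Delta>. T \<tau> (T w x) \<in> W} \<inter> initial_part \<Delta> ((g \<circ> f) r))"
          by (simp add: O'(2))
      qed
    qed
    then show ?thesis
      unfolding semigroup_frequently_hypercyclic_def by blast
  qed
  ultimately show ?thesis
    by blast
qed

end
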